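(* Consider a continuous-time Markov decision model as described in the context and suppose Assumptions A, B and C hold. Let $\pi=(\pi_t)\in\Pi$. (a) If there exist a constant $g$ and a function $u\in B_w(S)$ such that $$g\ge r(x,\pi_t)+\int_S u(y)\,q(dy|x,\pi_t)\quad\forall x\in S,\ t\ge0,$$ then $g\ge V(x,\pi)$ for all $x\in S$. (b) If there exist a constant $g$ and a function $u\in B_w(S)$ such that $$g\le r(x,\pi_t)+\int_S u(y)\,q(dy|x,\pi_t)\quad\forall x\in S,\ t\ge0,$$ then $g\le V(x,\pi)$ for all $x\in S$.
   Context: Model: $S$ (state space) and $A$ (action space) are Polish spaces with Borel $\sigma$-algebras $\mathcal{B}(\cdot)$; for each $x\in S$, $A(x)\subset A$ is a Borel set of admissible actions, and $K:=\{(x,a):x\in S,a\in A(x)\}$ is a Borel subset of $S\times A$. Transition rates $q(\cdot|x,a)$, $(x,a)\in K$, satisfy: $q(\cdot|x,a)$ is a signed measure on $\mathcal{B}(S)$ and $q(D|\cdot,\cdot)$ is Borel measurable on $K$ for each $D$; $0\le q(D|x,a)<\infty$ whenever $x\notin D$; $q(S|x,a)=0$ and $0\le -q(\{x\}|x,a)<\infty$; and $q(x):=\sup_{a\in A(x)}(-q(\{x\}|x,a))<\infty$ for all $x$. The reward rate $r:K\to\mathbb{R}$ is measurable. $I_D$ denotes the indicator of $D$. Policies: a randomized Markov policy $\pi=(\pi_t)$ is a family $\pi_t(B|x)$, $t\ge0$, such that each $\pi_t(\cdot|x)$ is a stochastic kernel on $A$ given $S$ with $\pi_t(A(x)|x)=1$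 and $t\mapsto\pi_t(B|x)$ is Borel measurable. It is admissible if $t\mapsto\int_{A(x)}h(a)\pi_t(da|x)$ is continuous for every $x$ and every bounded measurable $h$; $\Pi$ is the set of admissible policies. $F\subset\Pi$ is the set of (deterministic) stationary policies, i.e. measurable $f:S\to A$ with $f(x)\in A(x)$. Set $q(D|x,\pi_t):=\int_{A(x)}q(D|x,a)\pi_t(da|x)$ and $r(x,\pi_t):=\int_{A(x)}r(x,a)\pi_t(da|x)$. Assumption A: there exist a measurable $w\ge1$ on $S$ and constants $c>0$, $b\ge0$, $M_q>0$ with $\int_S w(y)q(dy|x,a)\le -cw(x)+b$ for all $(x,a)\in K$ and $q(x)\le M_q w(x)$ for all $x\in S$. Processes: under Assumption A, for each $\pi\in\Pi$ the minimal transition function $p^\pi(s,x,t,D)$ with transition rates $q(D|x,\pi_t)$ (i.e. $\lim_{\varepsilon\downarrow0}\varepsilon^{-1}[p^\pi(t,x,t+\varepsilon,D)-I_D(x)]=q(D|x,\pi_t)$) is regular. $x(t)$ denotes the corresponding Markov jump process; $E_x^\pi$ is the expectation when started at $x$ at time $0$. Average criterion: $V(x,\pi):=\liminf_{T\to\infty}\frac1T\int_0^T E_x^\pi[r(x(t),\pi_t)]\,dt$. Discounted criterion: for $\alpha>0$, $J_\alpha(x,\pi):=\int_0^\infty e^{-\alpha t}E_x^\pi[r(x(t),\pi_t)]dt$ and $J_\alpha^*(x):=\sup_{\pi\in\Pi}J_\alpha(x,\pi)$. Assumption B: (1) each $A(x)$ is compact; (2) for each $x$, $r(x,a)$ is continuous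 in $a\in A(x)$, and $a\mapsto\int_S u(y)q(dy|x,a)$ is continuous on $A(x)$ for every bounded measurable $u$ and for $u=w$; (3) $|r(x,a)|\le Mw(x)$ for all $(x,a)\in K$ for some constant $M>0$; (4) there exist a nonnegative measurable $w'$ on $S$ and constants $c'>0$, $b'\ge0$, $M'>0$ with $q(x)w(x)\le M'w'(x)$ and $\int_S w'(y)q(dy|x,a)\le c'w'(x)+b'$ for all $(x,a)\in K$. $B_w(S)$ is the space of measurable $u$ on $S$ with $\sup_x|u(x)|/w(x)<\infty$. Assumption C: there exist $v_1,v_2\in B_w(S)$ and a state $x_0\in S$ such that $v_1(x)\le J_\alpha^*(x)-J_\alpha^*(x_0)\le v_2(x)$ for all $x\in S$ and all $\alpha>0$. *)

theory Defs
  imports "HOL-Probability.Probability"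
begin

definition signed_measure_on :: "('s::topological_space set \<Rightarrow> real) \<Rightarrow> bool" where
  "signed_measure_on Q \<longleftrightarrow>
     (\<forall>D::nat \<Rightarrow> 's set. range D \<subseteq> sets borel \<longrightarrow> disjoint_family D \<longrightarrow>
        (\<lambda>n. Q (D n)) sums Q (\<Union>(range D)))"

text \<open>For a transition-rate signed measure Q at the state x (nonnegative off x),
  the positive part of its Jordan decomposition is Q restricted to S - {x};
  the negative part is the point mass -Q({x}) at x.\<close>
definition jump_meas :: "'s::topological_space \<Rightarrow> ('s set \<Rightarrow> real) \<Rightarrow> 's measure" where
  "jump_meas x Q = measure_of UNIV (sets borel) (\<lambda>D. ennreal (Q (D - {x})))"

text \<open>The integral of u with respect to the signed measure Q (Jordan decomposition).\<close>
definition rate_int :: "'s::topological_space \<Rightarrow> ('s set \<Rightarrow> real) \<Rightarrow> ('s \<Rightarrow> real) \<Rightarrow> real" where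
  "rate_int x Q u = (\<integral>y. u y \<partial>jump_meas x Q) + u x * Q {x}"

definition rate_integrable :: "'s::topological_space \<Rightarrow> ('s set \<Rightarrow> real) \<Rightarrow> ('s \<Rightarrow> real) \<Rightarrow> bool" where
  "rate_integrable x Q u \<longleftrightarrow> integrable (jump_meas x Q) u"

definition Kset :: "('s \<Rightarrow> 'a set) \<Rightarrow> ('s \<times> 'a) set" where
  "Kset A = {(x, a). a \<in> A x}"

definition qrate :: "('s \<Rightarrow> 'a set) \<Rightarrow> ('s \<Rightarrow> 'a \<Rightarrow> 's set \<Rightarrow> real) \<Rightarrow> 's \<Rightarrow> real" where
  "qrate A q x = (SUP a\<in>A x. - q x a {x})"

definition ctmdp_model ::
  "('s::polish_space \<Rightarrow> 'a::polish_space set) \<Rightarrow> ('s \<Rightarrow> 'a \<Rightarrow> 's set \<Rightarrow> real) \<Rightarrow> ('s \<Rightarrow> 'a \<Rightarrow> real) \<Rightarrow> bool" where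
  "ctmdp_model A q r \<longleftrightarrow>
     (\<forall>x. A x \<in> sets borel) \<and>
     Kset A \<in> sets (borel :: ('s \<times> 'a) measure) \<and>
     (\<forall>x a. a \<in> A x \<longrightarrow> signed_measure_on (q x a)) \<and>
     (\<forall>D \<in> sets borel. (\<lambda>(x, a). q x a D) \<in> borel_measurable (restrict_space borel (Kset A))) \<and>
     (\<forall>x a D. a \<in> A x \<longrightarrow> D \<in> sets borel \<longrightarrow> x \<notin> D \<longrightarrow> 0 \<le> q x a D) \<and>
     (\<forall>x a. a \<in> A x \<longrightarrow> q x a UNIV = 0 \<and> 0 \<le> - q x a {x}) \<and>
     (\<forall>x. bdd_above ((\<lambda>a. - q x a {x}) ` A x)) \<and>
     (\<lambda>(x, a). r x a) \<in> borel_measurable (restrict_space borel (Kset A))"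

definition markov_policy :: "('s::topological_space \<Rightarrow> 'a::topological_space set) \<Rightarrow> (real \<Rightarrow> 's \<Rightarrow> 'a measure) \<Rightarrow> bool" where
  "markov_policy A \<pi> \<longleftrightarrow>
     (\<forall>t\<ge>0. \<forall>x. prob_space (\<pi> t x) \<and> sets (\<pi> t x) = sets borel \<and> emeasure (\<pi> t x) (A x) = 1) \<and>
     (\<forall>t\<ge>0. \<forall>B \<in> sets borel. (\<lambda>x. measure (\<pi> t x) B) \<in> borel_measurable borel) \<and>
     (\<forall>x. \<forall>B \<in> sets borel. (\<lambda>t. measure (\<pi> t x) B) \<in> borel_measurable (restrict_space borel {0..}))"

definition admissible_policies :: "('s::topological_space \<Rightarrow> 'a::topological_space set) \<Rightarrow> (real \<Rightarrow> 's \<Rightarrow> 'a measure) set" where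
  "admissible_policies A = {\<pi>. markov_policy A \<pi> \<and>
     (\<forall>x (h :: 'a \<Rightarrow> real). h \<in> borel_measurable borel \<longrightarrow> bounded (range h) \<longrightarrow>
        continuous_on {0..} (\<lambda>t. \<integral>a. h a \<partial>\<pi> t x))}"

definition Qpi :: "('s \<Rightarrow> 'a set) \<Rightarrow> ('s \<Rightarrow> 'a \<Rightarrow> 's set \<Rightarrow> real) \<Rightarrow> (real \<Rightarrow> 's \<Rightarrow> 'a measure)
    \<Rightarrow> real \<Rightarrow> 's \<Rightarrow> 's set \<Rightarrow> real" where
  "Qpi A q \<pi> t x D = (LINT a:A x|\<pi> t x. q x a D)"

definition rpi :: "('s \<Rightarrow> 'a set) \<Rightarrow> ('s \<Rightarrow> 'a \<Rightarrow> real) \<Rightarrow> (real \<Rightarrow> 's \<Rightarrow> 'a measure) \<Rightarrow> real \<Rightarrow> 's \<Rightarrow> real" where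
  "rpi A r \<pi> t x = (LINT a:A x|\<pi> t x. r x a)"

text \<open>Feller's backward construction of the minimal transition function for time-dependent
  rates Q t x D = q(D|x,pi_t): pmin_iter n s x t D is the probability of exactly n jumps
  in [s,t] and ending in D.\<close>
fun pmin_iter :: "nat \<Rightarrow> (real \<Rightarrow> 's::topological_space \<Rightarrow> 's set \<Rightarrow> real) \<Rightarrow> real \<Rightarrow> 's \<Rightarrow> real \<Rightarrow> 's set \<Rightarrow> ennreal" where
  "pmin_iter 0 Q s x t D =
     indicator D x * ennreal (exp (- (LINT v:{s..t}|lborel. - Q v x {x})))"
| "pmin_iter (Suc n) Q s x t D =
     (\<integral>\<^sup>+ u. indicator {s..t} u * ennreal (exp (- (LINT v:{s..u}|lborel. - Q v x {x})))
        * (\<integral>\<^sup>+ y. pmin_iter n Q u y t D \<partial>jump_meas x (Q u x)) \<partial>lborel)"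

definition pmin :: "(real \<Rightarrow> 's::topological_space \<Rightarrow> 's set \<Rightarrow> real) \<Rightarrow> real \<Rightarrow> 's \<Rightarrow> real \<Rightarrow> 's set \<Rightarrow> ennreal" where
  "pmin Q s x t D = (\<Sum>n. pmin_iter n Q s x t D)"

definition trans_meas :: "(real \<Rightarrow> 's::topological_space \<Rightarrow> 's set \<Rightarrow> real) \<Rightarrow> real \<Rightarrow> 's \<Rightarrow> real \<Rightarrow> 's measure" where
  "trans_meas Q s x t = measure_of UNIV (sets borel) (pmin Q s x t)"

definition exp_reward :: "('s::topological_space \<Rightarrow> 'a set) \<Rightarrow> ('s \<Rightarrow> 'a \<Rightarrow> 's set \<Rightarrow> real) \<Rightarrow> ('s \<Rightarrow> 'a \<Rightarrow> real)
    \<Rightarrow> (real \<Rightarrow> 's \<Rightarrow> 'a measure) \<Rightarrow> 's \<Rightarrow> real \<Rightarrow> real" where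
  "exp_reward A q r \<pi> x t = (\<integral>y. rpi A r \<pi> t y \<partial>trans_meas (Qpi A q \<pi>) 0 x t)"

definition avg_reward :: "('s::topological_space \<Rightarrow> 'a set) \<Rightarrow> ('s \<Rightarrow> 'a \<Rightarrow> 's set \<Rightarrow> real) \<Rightarrow> ('s \<Rightarrow> 'a \<Rightarrow> real)
    \<Rightarrow> (real \<Rightarrow> 's \<Rightarrow> 'a measure) \<Rightarrow> 's \<Rightarrow> ereal" where
  "avg_reward A q r \<pi> x =
     Liminf at_top (\<lambda>T. ereal ((1 / T) * (LINT t:{0..T}|lborel. exp_reward A q r \<pi> x t)))"

definition disc_reward :: "('s::topological_space \<Rightarrow> 'a set) \<Rightarrow> ('s \<Rightarrow> 'a \<Rightarrow> 's set \<Rightarrow> real) \<Rightarrow> ('s \<Rightarrow> 'a \<Rightarrow> real)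
    \<Rightarrow> real \<Rightarrow> (real \<Rightarrow> 's \<Rightarrow> 'a measure) \<Rightarrow> 's \<Rightarrow> real" where
  "disc_reward A q r \<alpha> \<pi> x = (LINT t:{0..}|lborel. exp (- \<alpha> * t) * exp_reward A q r \<pi> x t)"

definition opt_disc :: "('s::topological_space \<Rightarrow> 'a::topological_space set) \<Rightarrow> ('s \<Rightarrow> 'a \<Rightarrow> 's set \<Rightarrow> real)
    \<Rightarrow> ('s \<Rightarrow> 'a \<Rightarrow> real) \<Rightarrow> real \<Rightarrow> 's \<Rightarrow> real" where
  "opt_disc A q r \<alpha> x = (SUP \<pi>\<in>admissible_policies A. disc_reward A q r \<alpha> \<pi> x)"

definition Bw :: "('s::topological_space \<Rightarrow> real) \<Rightarrow> ('s \<Rightarrow> real) set" where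
  "Bw w = {u. u \<in> borel_measurable borel \<and> bdd_above (range (\<lambda>x. \<bar>u x\<bar> / w x))}"

definition assumption_A :: "('s::topological_space \<Rightarrow> 'a set) \<Rightarrow> ('s \<Rightarrow> 'a \<Rightarrow> 's set \<Rightarrow> real)
    \<Rightarrow> ('s \<Rightarrow> real) \<Rightarrow> real \<Rightarrow> real \<Rightarrow> real \<Rightarrow> bool" where
  "assumption_A A q w c b Mq \<longleftrightarrow>
     w \<in> borel_measurable borel \<and> (\<forall>x. 1 \<le> w x) \<and> c > 0 \<and> b \<ge> 0 \<and> Mq > 0 \<and>
     (\<forall>x a. a \<in> A x \<longrightarrow> rate_integrable x (q x a) w \<and> rate_int x (q x a) w \<le> - c * w x + b) \<and>
     (\<forall>x. qrate A q x \<le> Mq * w x)"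

definition assumption_B :: "('s::topological_space \<Rightarrow> 'a::topological_space set) \<Rightarrow> ('s \<Rightarrow> 'a \<Rightarrow> 's set \<Rightarrow> real)
    \<Rightarrow> ('s \<Rightarrow> 'a \<Rightarrow> real) \<Rightarrow> ('s \<Rightarrow> real) \<Rightarrow> real \<Rightarrow> ('s \<Rightarrow> real) \<Rightarrow> real \<Rightarrow> real \<Rightarrow> real \<Rightarrow> bool" where
  "assumption_B A q r w M w' c' b' M' \<longleftrightarrow>
     (\<forall>x. compact (A x)) \<and>
     (\<forall>x. continuous_on (A x) (r x)) \<and>
     (\<forall>x (u :: 's \<Rightarrow> real). u \<in> borel_measurable borel \<longrightarrow> bounded (range u) \<longrightarrow>
        continuous_on (A x) (\<lambda>a. rate_int x (q x a) u)) \<and>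
     (\<forall>x. continuous_on (A x) (\<lambda>a. rate_int x (q x a) w)) \<and>
     M > 0 \<and> (\<forall>x a. a \<in> A x \<longrightarrow> \<bar>r x a\<bar> \<le> M * w x) \<and>
     w' \<in> borel_measurable borel \<and> (\<forall>x. 0 \<le> w' x) \<and> c' > 0 \<and> b' \<ge> 0 \<and> M' > 0 \<and>
     (\<forall>x. qrate A q x * w x \<le> M' * w' x) \<and>
     (\<forall>x a. a \<in> A x \<longrightarrow> rate_integrable x (q x a) w' \<and> rate_int x (q x a) w' \<le> c' * w' x + b')"

definition assumption_C :: "('s::topological_space \<Rightarrow> 'a::topological_space set) \<Rightarrow> ('s \<Rightarrow> 'a \<Rightarrow> 's set \<Rightarrow> real)
    \<Rightarrow> ('s \<Rightarrow> 'a \<Rightarrow> real) \<Rightarrow> ('s \<Rightarrow> real) \<Rightarrow> bool" where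
  "assumption_C A q r w \<longleftrightarrow>
     (\<exists>v1 \<in> Bw w. \<exists>v2 \<in> Bw w. \<exists>x0. \<forall>\<alpha>>0. \<forall>x.
        v1 x \<le> opt_disc A q r \<alpha> x - opt_disc A q r \<alpha> x0 \<and>
        opt_disc A q r \<alpha> x - opt_disc A q r \<alpha> x0 \<le> v2 x)"

end

theory Submission
  imports Defs
begin

text \<open>Let N f be the sum over n of the n-fold iterates of the one-jump operator of the backward construction,
  so that N applied to \<phi> times the survival probability is the expectation of \<phi>(x(T)). A function \<phi> that does not depend on time
  is the survival probability times \<phi> plus the integral of \<lambda>\<phi> along the time spent in the current state, while N f is f plus
  N of the one-jump image of f. Evaluating N \<phi> in these two ways (and using Tonelli in the time variable) yields Dynkin's formula
  for nonnegative \<phi> as an identity between possibly infinite quantities. Supersolutions of the backward equation dominate N,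
  which turns the drift conditions into bounds on the expectations of w and w'; with \<lambda>w \<le> M'w' they
  make N w finite. Hence all terms of Dynkin's formula are finite for u in the weighted space, and for \<phi> = 1 the process does not explode.
  Integrating the assumed inequality over [0,T], the expectation of u(x(T)) stays bounded in T and disappears after division by T.\<close>

subsection \<open>Integration against kernels\<close>

text \<open>No path space and no forward equation are at hand: the transition function is only a
  series of iterated integrals, and u is signed and unbounded, so that the generator terms could be
  differences of infinities. For this reason every identity is proved for \<open>ennreal\<close>
  functions with terms added and never subtracted; real numbers return only after finiteness is
  known. The two weights have different tasks. Dynkin's formula for w contains the expectation of
  \<lambda>w, which the drift of w does not control, whereas \<lambda>w \<le> M'w' does. The
  resulting bound grows exponentially in T, which is harmless: it only licenses cancellation at a
  fixed T. The bound that has to be uniform in T is w(x) + b/c, and it comes from the negative drift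
  -c. A second obstacle is joint measurability: the set {x} moves with the state, and a policy is
  regular in time and in the state only separately.\<close>

lemma pred_in_Icc [measurable (raw)]:
  fixes a b c :: "'z \<Rightarrow> real"
  assumes [measurable]: "a \<in> borel_measurable N" "b \<in> borel_measurable N" "c \<in> borel_measurable N"
  shows "Measurable.pred N (\<lambda>z. c z \<in> {a z..b z})"
  unfolding atLeastAtMost_iff by measurable

text \<open>Dividing the kernel by 1 plus its total mass gives a subprobability kernel, whose
  integrals depend measurably on the parameter; multiplying back restores the original integral. The
  summand 1 keeps the divisor nonzero where the kernel vanishes.\<close>

lemma nn_integral_measurable_finite_kernel:
  assumes f: "(\<lambda>(z, y). f z y) \<in> borel_measurable (M \<Otimes>\<^sub>M N)"
    and sets: "\<And>z. z \<in> space M \<Longrightarrow> sets (K z) = sets N"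
    and meas: "\<And>D. D \<in> sets N \<Longrightarrow> (\<lambda>z. emeasure (K z) D) \<in> borel_measurable M"
    and fin: "\<And>z. z \<in> space M \<Longrightarrow> emeasure (K z) (space N) < \<infinity>"
    and ne: "space N \<noteq> {}"
  shows "(\<lambda>z. \<integral>\<^sup>+y. f z y \<partial>K z) \<in> borel_measurable M"
proof -
  define m where "m z = 1 + emeasure (K z) (space N)" for z
  have m[measurable]: "m \<in> borel_measurable M" unfolding m_def using meas[of "space N"] by simp
  have m_ne: "m z \<noteq> 0" for z by (simp add: m_def)
  have m_fin: "m z \<noteq> \<infinity>" if "z \<in> space M" for z using fin[OF that] by (auto simp: m_def less_top)
  define L where "L z = scale_measure (inverse (m z)) (K z)" for z
  have [measurable]: "L \<in> measurable M (subprob_algebra N)"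
  proof (rule measurable_subprob_algebra)
    fix z assume z: "z \<in> space M"
    have sp: "space (K z) = space N" using sets[OF z] by (rule sets_eq_imp_space_eq)
    show "subprob_space (L z)"
    proof
      show "space (L z) \<noteq> {}" using ne sp by (simp add: L_def space_scale_measure)
      have "emeasure (L z) (space (L z)) = inverse (m z) * emeasure (K z) (space N)"
        by (simp add: L_def space_scale_measure sp)
      also have "\<dots> \<le> inverse (m z) * m z" by (intro mult_left_mono) (auto simp: m_def)
      also have "\<dots> = 1" using m_ne[of z] m_fin[OF z]
        by (metis ennreal_inverse_mult infinity_ennreal_def mult.commute divide_ennreal_def ennreal_divide_self less_top)
      finally show "emeasure (L z) (space (L z)) \<le> 1" .
    qed
    show "sets (L z) = sets N" using sets[OF z] by (simp add: L_def)
  next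
    fix D assume "D \<in> sets N"
    from meas[OF this] have [measurable]: "(\<lambda>z. emeasure (K z) D) \<in> borel_measurable M" .
    have "(\<lambda>z. inverse (m z) * emeasure (K z) D) \<in> borel_measurable M" by measurable
    then show "(\<lambda>z. emeasure (L z) D) \<in> borel_measurable M" by (simp add: L_def)
  qed
  have "(\<lambda>z. m z * (\<integral>\<^sup>+y. f z y \<partial>L z)) \<in> borel_measurable M"
    by (intro borel_measurable_times_ennreal m nn_integral_measurable_subprob_algebra2[OF f]) measurable
  also have "?this \<longleftrightarrow> ?thesis"
  proof (rule measurable_cong)
    fix z assume z: "z \<in> space M"
    have [measurable]: "f z \<in> borel_measurable (K z)"
      using measurable_compose_Pair1[OF z f] sets[OF z] by (simp cong: measurable_cong_sets)
    have "m z * (\<integral>\<^sup>+y. f z y \<partial>L z) = (m z * inverse (m z)) * (\<integral>\<^sup>+y. f z y \<partial>K z)"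
      by (simp add: L_def nn_integral_scale_measure mult.assoc)
    also have "m z * inverse (m z) = 1" using m_ne[of z] m_fin[OF z]
      by (metis infinity_ennreal_def divide_ennreal_def ennreal_divide_self less_top)
    finally show "m z * (\<integral>\<^sup>+y. f z y \<partial>L z) = (\<integral>\<^sup>+y. f z y \<partial>K z)" by simp
  qed
  finally show ?thesis .
qed

text \<open>A Daniell-type principle: additivity, homogeneity and monotone continuity make the set
  function on indicators countably additive, and the same properties carry the equality from
  indicators to all measurable functions. It serves both the jump measure averaged over actions and
  the measure built from the series of iterates.\<close>

lemma nn_integral_measure_of_functional:
  fixes \<Phi> :: "('s \<Rightarrow> ennreal) \<Rightarrow> ennreal" and M :: "'s measure"
  assumes add: "\<And>f g. f \<in> borel_measurable M \<Longrightarrow> g \<in> borel_measurable M \<Longrightarrow> \<Phi> (\<lambda>x. f x + g x) = \<Phi> f + \<Phi> g"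
    and cmult: "\<And>f c. f \<in> borel_measurable M \<Longrightarrow> \<Phi> (\<lambda>x. c * f x) = c * \<Phi> f"
    and SUP: "\<And>F. (\<And>i::nat. F i \<in> borel_measurable M) \<Longrightarrow> incseq F \<Longrightarrow> \<Phi> (\<lambda>x. SUP i. F i x) = (SUP i. \<Phi> (F i))"
    and cong: "\<And>f g. (\<And>x. x \<in> space M \<Longrightarrow> f x = g x) \<Longrightarrow> \<Phi> f = \<Phi> g"
    and f: "f \<in> borel_measurable M"
  shows "(\<integral>\<^sup>+x. f x \<partial>measure_of (space M) (sets M) (\<lambda>D. \<Phi> (indicator D))) = \<Phi> f"
proof -
  define N where "N = measure_of (space M) (sets M) (\<lambda>D. \<Phi> (indicator D))"
  have sets_N: "sets N = sets M" by (simp add: N_def sets.space_closed sets.sigma_sets_eq)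
  have space_N: "space N = space M" by (simp add: N_def sets.space_closed)
  have zero: "\<Phi> (\<lambda>x. 0) = 0" using cmult[of "\<lambda>x. 0" 0] by simp
  have fin: "\<Phi> (\<lambda>x. \<Sum>i<n. F i x) = (\<Sum>i<n. \<Phi> (F i))"
    if "\<And>i. F i \<in> borel_measurable M" for F and n :: nat
    using that by (induction n) (auto simp: zero add)
  have N: "emeasure N D = \<Phi> (indicator D)" if "D \<in> sets M" for D
    unfolding N_def
  proof (rule emeasure_measure_of_sigma)
    show "sigma_algebra (space M) (sets M)" ..
    show "positive (sets M) (\<lambda>D. \<Phi> (indicator D))"
      using zero by (simp add: positive_def indicator_def[abs_def])
    show "countably_additive (sets M) (\<lambda>D. \<Phi> (indicator D))"
    proof (rule countably_additiveI)
      fix B :: "nat \<Rightarrow> 's set" assume B: "range B \<subseteq> sets M" "disjoint_family B"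
      have [measurable]: "B i \<in> sets M" for i using B by auto
      have "\<Phi> (indicator (\<Union>i. B i)) = \<Phi> (\<lambda>x. SUP n. \<Sum>i<n. indicator (B i) x)"
        by (intro cong) (simp add: suminf_eq_SUP[symmetric] suminf_indicator[OF B(2)])
      also have "\<dots> = (SUP n. \<Phi> (\<lambda>x. \<Sum>i<n. indicator (B i) x))"
        by (intro SUP) (auto simp: incseq_def le_fun_def intro!: sum_mono2)
      also have "\<dots> = (\<Sum>i. \<Phi> (indicator (B i)))"
        by (simp add: fin suminf_eq_SUP)
      finally show "(\<Sum>i. \<Phi> (indicator (B i))) = \<Phi> (indicator (\<Union> (range B)))" by simp
    qed
    show "D \<in> sets M" by fact
  qed
  have "(\<integral>\<^sup>+x. f x \<partial>N) = \<Phi> f"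
    using f
  proof (induction rule: borel_measurable_induct)
    case (cong f g)
    have "(\<integral>\<^sup>+x. f x \<partial>N) = (\<integral>\<^sup>+x. g x \<partial>N)"
      using cong.hyps by (intro nn_integral_cong) (simp add: space_N)
    with cong show ?case using assms(4)[of f g] by simp
  next
    case (set D)
    then show ?case by (simp add: N sets_N)
  next
    case (mult u c)
    then show ?case by (simp add: nn_integral_cmult cmult measurable_cong_sets[OF sets_N refl])
  next
    case (add u v)
    then show ?case by (simp add: nn_integral_add assms(1) measurable_cong_sets[OF sets_N refl])
  next
    case (seq U)
    have "(\<integral>\<^sup>+x. (SUP i. U i) x \<partial>N) = (\<integral>\<^sup>+x. (SUP i. U i x) \<partial>N)" by (simp add: SUP_apply image_comp)
    also have "\<dots> = (SUP i. \<integral>\<^sup>+x. U i x \<partial>N)"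
      using seq by (intro nn_integral_monotone_convergence_SUP) (auto simp: measurable_cong_sets[OF sets_N refl])
    also have "\<dots> = \<Phi> (\<lambda>x. SUP i. U i x)" using seq by (simp add: SUP)
    finally show ?case by (simp add: SUP_apply image_comp)
  qed
  then show ?thesis by (simp add: N_def)
qed

subsection \<open>Survival probabilities and the one-jump operator\<close>

text \<open>The rates on the whole time axis, freed from actions and policies. Conservativeness,
  q(S|x,a) = 0, survives as the requirement that \<open>J t x\<close> has total mass
  \<open>lam t x\<close>; continuity in time makes the survival probability differentiable.\<close>

locale jump_rates =
  fixes lam :: "real \<Rightarrow> 's::polish_space \<Rightarrow> real" and J :: "real \<Rightarrow> 's \<Rightarrow> 's measure"
  assumes lam_nonneg: "0 \<le> lam t x"
    and lam_meas: "(\<lambda>(t, x). lam t x) \<in> borel_measurable (borel \<Otimes>\<^sub>M borel)"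
    and lam_cont: "continuous_on UNIV (\<lambda>t. lam t x)"
    and sets_J [simp, measurable_cong]: "sets (J t x) = sets borel"
    and emeasure_J_meas: "D \<in> sets borel \<Longrightarrow> (\<lambda>(t, x). emeasure (J t x) D) \<in> borel_measurable (borel \<Otimes>\<^sub>M borel)"
    and emeasure_J_UNIV: "emeasure (J t x) UNIV = ennreal (lam t x)"
begin

lemma lam_measurable [measurable (raw)]:
  assumes [measurable]: "f \<in> borel_measurable N" "g \<in> measurable N borel"
  shows "(\<lambda>z. lam (f z) (g z)) \<in> borel_measurable N"
  using measurable_compose[OF _ lam_meas, of "\<lambda>z. (f z, g z)" N] by simp

lemma nn_integral_J_measurable [measurable (raw)]:
  assumes [measurable]: "f \<in> borel_measurable N" "g \<in> measurable N borel"
    "(\<lambda>(z, y). h z y) \<in> borel_measurable (N \<Otimes>\<^sub>M borel)"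
  shows "(\<lambda>z. \<integral>\<^sup>+y. h z y \<partial>J (f z) (g z)) \<in> borel_measurable N"
proof (rule nn_integral_measurable_finite_kernel[where N = borel])
  fix D :: "'s set" assume "D \<in> sets borel"
  from measurable_compose[OF _ emeasure_J_meas[OF this], of "\<lambda>z. (f z, g z)" N]
  show "(\<lambda>z. emeasure (J (f z) (g z)) D) \<in> borel_measurable N" by simp
qed (simp_all add: emeasure_J_UNIV)

definition surv :: "real \<Rightarrow> real \<Rightarrow> 's \<Rightarrow> real" where
  "surv s u x = exp (- (LINT v:{s..u}|lborel. lam v x))"

lemma surv_measurable [measurable (raw)]:
  assumes [measurable]: "a \<in> borel_measurable N" "b \<in> borel_measurable N" "g \<in> measurable N borel"
  shows "(\<lambda>z. surv (a z) (b z) (g z)) \<in> borel_measurable N"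
  unfolding surv_def set_lebesgue_integral_def by measurable

lemma surv_pos: "0 < surv s u x" by (simp add: surv_def)

lemma surv_refl [simp]: "u \<le> s \<Longrightarrow> surv s u x = 1"
proof -
  assume "u \<le> s"
  then have "u < s \<or> u = s" by auto
  then have "(LINT v:{s..u}|lborel. lam v x) = 0"
  proof
    assume "u = s"
    then have "(LINT v:{s..u}|lborel. lam v x) = (LINT v:{s}|lborel. lam v x)" by simp
    also have "\<dots> = 0" unfolding set_lebesgue_integral_def
      by (intro integral_eq_zero_AE eventually_mono[OF AE_lborel_singleton[of s]]) auto
    finally show ?thesis .
  qed (simp add: set_lebesgue_integral_def)
  then show ?thesis by (simp add: surv_def)
qed

text \<open>\<open>surv s\<close> is constant to the left of s, so in general it has no two-sided
  derivative at s. The function F agrees with it from s on and is differentiable at s as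
  well.\<close>

lemma surv_deriv:
  "\<exists>F. (\<forall>v\<ge>s. F v = surv s v x) \<and> (\<forall>v\<ge>s. (F has_real_derivative - lam v x * surv s v x) (at v))"
proof -
  \<comment> \<open>The base point s - 1 puts every v \<ge> s into the interior of the interval of
    integration, so that the derivative at s is two-sided.\<close>
  define L where "L v = integral {s - 1..v} (\<lambda>v. lam v x)" for v
  define F where "F v = exp (- (L v - L s))" for v
  have cont: "continuous_on S (\<lambda>v. lam v x)" for S
    using lam_cont continuous_on_subset by blast
  have F: "F v = surv s v x" if "s \<le> v" for v
  proof -
    have "L s + integral {s..v} (\<lambda>v. lam v x) = L v"
      unfolding L_def using that by (intro Henstock_Kurzweil_Integration.integral_combine integrable_continuous_real cont) auto
    moreover have "(LINT v:{s..v}|lborel. lam v x) = integral {s..v} (\<lambda>v. lam v x)"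
      by (intro set_borel_integral_eq_integral borel_integrable_atLeastAtMost' cont)
    ultimately show ?thesis by (simp add: F_def surv_def)
  qed
  have "(L has_real_derivative lam v x) (at v)" if "s \<le> v" for v
  proof -
    have "(L has_real_derivative lam v x) (at v within {s - 1..v + 1})"
      unfolding L_def using that by (intro integral_has_real_derivative cont) auto
    moreover have "at v within {s - 1..v + 1} = at v"
      using that by (intro at_within_Icc_at) auto
    ultimately show ?thesis by simp
  qed
  then have "(F has_real_derivative - lam v x * F v) (at v)" if "s \<le> v" for v
    unfolding F_def using that by (auto intro!: derivative_eq_intros)
  with F show ?thesis by (intro exI[of _ F]) auto
qed

text \<open>Variation of constants for the linear equation G' = lam G - h, written for the nonnegative integral.\<close>
lemma surv_FTC:
  assumes "s \<le> T" and G: "\<And>v. (G has_real_derivative G' v) (at v)"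
    and [measurable]: "G \<in> borel_measurable borel" "G' \<in> borel_measurable borel"
    and nonneg: "\<And>v. s \<le> v \<Longrightarrow> v \<le> T \<Longrightarrow> 0 \<le> lam v x * G v - G' v"
    and GT: "0 \<le> G T"
  shows "ennreal (G s) = ennreal (G T * surv s T x)
    + (\<integral>\<^sup>+v. indicator {s..T} v * ennreal (surv s v x) * ennreal (lam v x * G v - G' v) \<partial>lborel)"
proof -
  obtain F where F: "\<And>v. s \<le> v \<Longrightarrow> F v = surv s v x"
    "\<And>v. s \<le> v \<Longrightarrow> (F has_real_derivative - lam v x * surv s v x) (at v)"
    using surv_deriv by blast
  define f where "f v = surv s v x * (lam v x * G v - G' v)" for v
  have f0: "0 \<le> f v" if "v \<in> {s..T}" for v
    using nonneg that surv_pos[of s v x] by (simp add: f_def)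
  have meas: "f \<in> borel_measurable borel" unfolding f_def by measurable
  \<comment> \<open>By the product rule \<open>f\<close> is the derivative of
    \<open>- F v * G v\<close>, so its nonnegative integral is a difference of boundary
    values.\<close>
  have der: "((\<lambda>v. - F v * G v) has_real_derivative f v) (at v)" if "v \<in> {s..T}" for v
    using that F by (auto intro!: derivative_eq_intros G simp: f_def algebra_simps)
  have "(\<integral>\<^sup>+v. ennreal (f v) * indicator {s..T} v \<partial>lborel) = ennreal (- F T * G T - (- F s * G s))"
    by (intro nn_integral_FTC_Icc) (use meas der f0 \<open>s \<le> T\<close> in auto)
  also have "- F T * G T - (- F s * G s) = G s - G T * surv s T x"
    using F(1)[of T] F(1)[of s] \<open>s \<le> T\<close> by simp
  also have "(\<integral>\<^sup>+v. ennreal (f v) * indicator {s..T} v \<partial>lborel) =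
     (\<integral>\<^sup>+v. indicator {s..T} v * ennreal (surv s v x) * ennreal (lam v x * G v - G' v) \<partial>lborel)"
    using surv_pos[of s _ x] nonneg
    by (intro nn_integral_cong) (auto simp: f_def ennreal_mult less_imp_le split: split_indicator)
  finally have *: "(\<integral>\<^sup>+v. indicator {s..T} v * ennreal (surv s v x) * ennreal (lam v x * G v - G' v) \<partial>lborel)
    = ennreal (G s - G T * surv s T x)" by simp
  \<comment> \<open>Monotonicity shows that the real difference
    \<open>G s - G T * surv s T x\<close> is nonnegative; otherwise \<open>ennreal\<close> would
    truncate it and the two terms could not be added back.\<close>
  have "- F s * G s \<le> - F T * G T"
    using \<open>s \<le> T\<close> der f0 by (intro DERIV_nonneg_imp_nondecreasing[of s T "\<lambda>v. - F v * G v"]) fastforce+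
  then have "G T * surv s T x \<le> G s"
    using F(1)[of T] F(1)[of s] \<open>s \<le> T\<close> by (simp add: mult.commute)
  then show ?thesis
    unfolding * using GT surv_pos[of s T x] by (subst ennreal_plus[symmetric]) auto
qed

text \<open>The case G = 1 of \<open>surv_FTC\<close>, multiplied by \<phi> x, which may be
  infinite. For T < s the interval is empty and the survival probability is 1.\<close>

lemma surv_const:
  assumes [measurable]: "\<phi> \<in> borel_measurable borel"
  shows "\<phi> x = \<phi> x * ennreal (surv s T x)
    + (\<integral>\<^sup>+v. indicator {s..T} v * ennreal (surv s v x) * (ennreal (lam v x) * \<phi> x) \<partial>lborel)"
proof (cases "s \<le> T")
  case True
  have "1 = ennreal (surv s T x) + (\<integral>\<^sup>+v. indicator {s..T} v * ennreal (surv s v x) * ennreal (lam v x) \<partial>lborel)"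
    using surv_FTC[OF True, of "\<lambda>v. 1" "\<lambda>v. 0" x] lam_nonneg by simp
  then have "\<phi> x = \<phi> x * (ennreal (surv s T x) + (\<integral>\<^sup>+v. indicator {s..T} v * ennreal (surv s v x) * ennreal (lam v x) \<partial>lborel))"
    by (metis mult.right_neutral)
  also have "\<dots> = \<phi> x * ennreal (surv s T x)
    + (\<integral>\<^sup>+v. \<phi> x * (indicator {s..T} v * ennreal (surv s v x) * ennreal (lam v x)) \<partial>lborel)"
    by (simp add: nn_integral_cmult distrib_left)
  finally show ?thesis by (simp add: ac_simps)
next
  case False
  then show ?thesis by simp
qed

section \<open>First-jump operator, its iterates and their sum\<close>

definition step :: "real \<Rightarrow> (real \<Rightarrow> 's \<Rightarrow> ennreal) \<Rightarrow> real \<Rightarrow> 's \<Rightarrow> ennreal" where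
  "step T f s x = (\<integral>\<^sup>+u. indicator {s..T} u * ennreal (surv s u x) * (\<integral>\<^sup>+y. f u y \<partial>J u x) \<partial>lborel)"

text \<open>The operator N of the overview: the potential operator of the embedded chain of jump
  times and post-jump states, killed at the horizon T.\<close>

definition pot :: "real \<Rightarrow> (real \<Rightarrow> 's \<Rightarrow> ennreal) \<Rightarrow> real \<Rightarrow> 's \<Rightarrow> ennreal" where
  "pot T f s x = (\<Sum>n. (step T ^^ n) f s x)"

definition occ :: "real \<Rightarrow> (real \<Rightarrow> 's \<Rightarrow> ennreal) \<Rightarrow> real \<Rightarrow> 's \<Rightarrow> ennreal" where
  "occ T h s x = (\<integral>\<^sup>+u. indicator {s..T} u * ennreal (surv s u x) * h u x \<partial>lborel)"

definition no_jump :: "real \<Rightarrow> ('s \<Rightarrow> ennreal) \<Rightarrow> real \<Rightarrow> 's \<Rightarrow> ennreal" where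
  "no_jump T \<phi> s x = \<phi> x * ennreal (surv s T x)"

lemma step_occ: "step T f = occ T (\<lambda>u x. \<integral>\<^sup>+y. f u y \<partial>J u x)"
  by (simp add: fun_eq_iff step_def occ_def)

lemma triple_measurable:
  assumes f: "(\<lambda>(t, s, x). f t s x) \<in> borel_measurable (borel \<Otimes>\<^sub>M borel \<Otimes>\<^sub>M borel)"
    and [measurable]: "a \<in> measurable N borel" "b \<in> measurable N borel" "c \<in> measurable N borel"
  shows "(\<lambda>z. f (a z) (b z) (c z)) \<in> borel_measurable N"
  using measurable_compose[OF _ f, of "\<lambda>z. (a z, b z, c z)" N] by simp

text \<open>The horizon becomes an integration variable in \<open>step_pow_occ\<close>. Hence
  measurability is needed jointly in horizon, time and state, for an \<open>f\<close> that may
  itself depend on the horizon.\<close>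

lemma step_measurable_param:
  assumes f: "(\<lambda>(t, s, x). f t s x) \<in> borel_measurable (borel \<Otimes>\<^sub>M borel \<Otimes>\<^sub>M borel)"
  shows "(\<lambda>(t, s, x). step t (f t) s x) \<in> borel_measurable (borel \<Otimes>\<^sub>M borel \<Otimes>\<^sub>M borel)"
proof -
  note triple_measurable[OF f, measurable (raw)]
  show ?thesis unfolding step_def by measurable
qed

lemma step_pow_measurable_param:
  assumes "(\<lambda>(t, s, x). f t s x) \<in> borel_measurable (borel \<Otimes>\<^sub>M borel \<Otimes>\<^sub>M borel)"
  shows "(\<lambda>(t, s, x). (step t ^^ n) (f t) s x) \<in> borel_measurable (borel \<Otimes>\<^sub>M borel \<Otimes>\<^sub>M borel)"
proof (induction n)
  case (Suc n)
  from step_measurable_param[OF Suc] show ?case by (simp only: funpow.simps o_apply)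
qed (use assms in \<open>simp only: funpow.simps id_apply\<close>)

lemma pot_measurable_param:
  assumes "(\<lambda>(t, s, x). f t s x) \<in> borel_measurable (borel \<Otimes>\<^sub>M borel \<Otimes>\<^sub>M borel)"
  shows "(\<lambda>(t, s, x). pot t (f t) s x) \<in> borel_measurable (borel \<Otimes>\<^sub>M borel \<Otimes>\<^sub>M borel)"
proof -
  note triple_measurable[OF step_pow_measurable_param[OF assms], measurable (raw)]
  show ?thesis unfolding pot_def by measurable
qed

lemma step_measurable:
  assumes [measurable]: "case_prod f \<in> borel_measurable (borel \<Otimes>\<^sub>M borel)"
  shows "case_prod (step T f) \<in> borel_measurable (borel \<Otimes>\<^sub>M borel)"
  unfolding step_def by measurable

lemma step_pow_measurable:
  assumes "case_prod f \<in> borel_measurable (borel \<Otimes>\<^sub>M borel)"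
  shows "case_prod ((step T ^^ n) f) \<in> borel_measurable (borel \<Otimes>\<^sub>M borel)"
  using assms by (induction n) (simp_all only: funpow.simps id_apply o_apply step_measurable)

lemma step_mono:
  assumes "\<And>u y. s \<le> u \<Longrightarrow> u \<le> T \<Longrightarrow> f u y \<le> g u y"
  shows "step T f s x \<le> step T g s x"
  unfolding step_def using assms
  by (intro nn_integral_mono) (auto split: split_indicator intro!: mult_left_mono nn_integral_mono)

lemma step_add:
  assumes [measurable]: "case_prod f \<in> borel_measurable (borel \<Otimes>\<^sub>M borel)"
    "case_prod g \<in> borel_measurable (borel \<Otimes>\<^sub>M borel)"
  shows "step T (\<lambda>s x. f s x + g s x) s x = step T f s x + step T g s x"
  unfolding step_def by (simp add: nn_integral_add distrib_left)

lemma step_cmult: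
  assumes [measurable]: "case_prod f \<in> borel_measurable (borel \<Otimes>\<^sub>M borel)"
  shows "step T (\<lambda>s x. c * f s x) s x = c * step T f s x"
  unfolding step_def by (simp add: nn_integral_cmult mult.left_commute[of _ c])

lemma step_SUP:
  assumes [measurable]: "\<And>i::nat. case_prod (F i) \<in> borel_measurable (borel \<Otimes>\<^sub>M borel)"
    and inc: "\<And>s x. incseq (\<lambda>i. F i s x)"
  shows "step T (\<lambda>s x. SUP i. F i s x) s x = (SUP i. step T (F i) s x)"
proof -
  have inc_int: "incseq (\<lambda>i. \<integral>\<^sup>+y. F i u y \<partial>J u x)" for u x
    using inc by (auto simp: incseq_def intro!: nn_integral_mono)
  have "step T (\<lambda>s x. SUP i. F i s x) s x
    = (\<integral>\<^sup>+u. (SUP i. indicator {s..T} u * ennreal (surv s u x) * (\<integral>\<^sup>+y. F i u y \<partial>J u x)) \<partial>lborel)"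
    unfolding step_def using inc
    by (intro nn_integral_cong, subst nn_integral_monotone_convergence_SUP)
      (auto simp: SUP_mult_left_ennreal incseq_def le_fun_def)
  also have "\<dots> = (SUP i. step T (F i) s x)"
    unfolding step_def using inc_int
    by (intro nn_integral_monotone_convergence_SUP) (auto simp: incseq_def le_fun_def intro!: mult_left_mono)
  finally show ?thesis .
qed

lemma step_pow_add:
  assumes "case_prod f \<in> borel_measurable (borel \<Otimes>\<^sub>M borel)"
    "case_prod g \<in> borel_measurable (borel \<Otimes>\<^sub>M borel)"
  shows "(step T ^^ n) (\<lambda>s x. f s x + g s x) = (\<lambda>s x. (step T ^^ n) f s x + (step T ^^ n) g s x)"
proof (induction n)
  case (Suc n)
  show ?case by (simp add: Suc step_add step_pow_measurable assms fun_eq_iff)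
qed simp

lemma step_pow_cmult:
  assumes "case_prod f \<in> borel_measurable (borel \<Otimes>\<^sub>M borel)"
  shows "(step T ^^ n) (\<lambda>s x. c * f s x) = (\<lambda>s x. c * (step T ^^ n) f s x)"
proof (induction n)
  case (Suc n)
  show ?case by (simp add: Suc step_cmult step_pow_measurable assms fun_eq_iff)
qed simp

lemma step_pow_mono:
  assumes "\<And>s x. f s x \<le> g s x"
  shows "(step T ^^ n) f s x \<le> (step T ^^ n) g s x"
  using assms by (induction n arbitrary: s x) (auto intro!: step_mono)

lemma step_pow_SUP:
  assumes meas: "\<And>i::nat. case_prod (F i) \<in> borel_measurable (borel \<Otimes>\<^sub>M borel)"
    and inc: "\<And>s x. incseq (\<lambda>i. F i s x)"
  shows "(step T ^^ n) (\<lambda>s x. SUP i. F i s x) = (\<lambda>s x. SUP i. (step T ^^ n) (F i) s x)"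
proof (induction n)
  case (Suc n)
  have "incseq (\<lambda>i. (step T ^^ n) (F i) s x)" for s x
    using inc by (auto simp: incseq_def intro!: step_pow_mono)
  then show ?case by (simp add: Suc step_SUP step_pow_measurable meas fun_eq_iff)
qed simp

lemma pot_add:
  assumes "case_prod f \<in> borel_measurable (borel \<Otimes>\<^sub>M borel)"
    "case_prod g \<in> borel_measurable (borel \<Otimes>\<^sub>M borel)"
  shows "pot T (\<lambda>s x. f s x + g s x) s x = pot T f s x + pot T g s x"
  unfolding pot_def step_pow_add[OF assms] by (intro suminf_add[symmetric] summableI)

lemma pot_cmult:
  assumes "case_prod f \<in> borel_measurable (borel \<Otimes>\<^sub>M borel)"
  shows "pot T (\<lambda>s x. c * f s x) s x = c * pot T f s x"
  unfolding pot_def step_pow_cmult[OF assms] by simp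

lemma pot_mono:
  assumes "\<And>s x. f s x \<le> g s x"
  shows "pot T f s x \<le> pot T g s x"
  unfolding pot_def by (intro suminf_le summableI step_pow_mono assms)

lemma pot_SUP:
  assumes meas: "\<And>i::nat. case_prod (F i) \<in> borel_measurable (borel \<Otimes>\<^sub>M borel)"
    and inc: "\<And>s x. incseq (\<lambda>i. F i s x)"
  shows "pot T (\<lambda>s x. SUP i. F i s x) s x = (SUP i. pot T (F i) s x)"
  unfolding pot_def step_pow_SUP[OF assms]
  using inc by (intro ennreal_suminf_SUP_eq) (auto simp: incseq_def intro!: step_pow_mono)

lemma pot_rec: "pot T f s x = f s x + pot T (step T f) s x"
proof -
  have "pot T f s x = (\<Sum>n. (step T ^^ (n + 1)) f s x) + (\<Sum>n<1. (step T ^^ n) f s x)"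
    unfolding pot_def by (rule suminf_offset) (rule summableI)
  then show ?thesis by (simp add: pot_def funpow_Suc_right add.commute del: funpow.simps)
qed

text \<open>A partial sum with n + 1 terms is f plus \<open>step\<close> of the partial sum with n
  terms. Monotonicity of \<open>step\<close> therefore keeps every partial sum below G by induction,
  and no finiteness enters.\<close>

lemma pot_le_supersolution:
  assumes f: "case_prod f \<in> borel_measurable (borel \<Otimes>\<^sub>M borel)"
    and G: "\<And>s x. f s x + step T G s x \<le> G s x"
  shows "pot T f s x \<le> G s x"
proof -
  have "(\<Sum>k<n. (step T ^^ k) f s x) \<le> G s x" for n s x
  proof (induction n arbitrary: s x)
    case (Suc n)
    have meas: "case_prod (\<lambda>s x. \<Sum>k<n. (step T ^^ k) f s x) \<in> borel_measurable (borel \<Otimes>\<^sub>M borel)" for n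
      using step_pow_measurable[OF f, measurable] by measurable
    have "(\<Sum>k<n. (step T ^^ Suc k) f s x) = step T (\<lambda>s x. \<Sum>k<n. (step T ^^ k) f s x) s x" for s x
    proof (induction n)
      case (Suc n)
      then show ?case
        using step_add[OF meas[of n] step_pow_measurable[OF f, where n = n]] by simp
    qed (simp add: step_def)
    then have "(\<Sum>k<Suc n. (step T ^^ k) f s x) = f s x + step T (\<lambda>s x. \<Sum>k<n. (step T ^^ k) f s x) s x"
      by (simp add: sum.lessThan_Suc_shift del: sum.lessThan_Suc)
    also have "\<dots> \<le> f s x + step T G s x"
      by (intro add_left_mono step_mono Suc.IH)
    also have "\<dots> \<le> G s x" by (rule G)
    finally show ?case .
  qed simp
  then show ?thesis unfolding pot_def by (intro suminf_le_const summableI)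
qed

section \<open>Occupation integrals and Dynkin's formula\<close>

lemma no_jump_measurable_param:
  assumes [measurable]: "case_prod h \<in> borel_measurable (borel \<Otimes>\<^sub>M borel)"
  shows "(\<lambda>(t, s, x). no_jump t (h t) s x) \<in> borel_measurable (borel \<Otimes>\<^sub>M borel \<Otimes>\<^sub>M borel)"
  unfolding no_jump_def by measurable

lemma no_jump_measurable:
  assumes [measurable]: "\<phi> \<in> borel_measurable borel"
  shows "case_prod (no_jump T \<phi>) \<in> borel_measurable (borel \<Otimes>\<^sub>M borel)"
  unfolding no_jump_def by measurable

lemma occ_measurable:
  assumes [measurable]: "case_prod h \<in> borel_measurable (borel \<Otimes>\<^sub>M borel)"
  shows "case_prod (occ T h) \<in> borel_measurable (borel \<Otimes>\<^sub>M borel)"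
  unfolding occ_def by measurable

lemma J_lborel: "pair_sigma_finite (J u x) lborel"
proof -
  have "finite_measure (J u x)"
    by (rule finite_measureI) (simp add: emeasure_J_UNIV sets_eq_imp_space_eq[OF sets_J])
  then show ?thesis
    by (simp add: pair_sigma_finite_def finite_measure.sigma_finite_measure lborel.sigma_finite_measure_axioms)
qed

text \<open>The time t spent in the state after n jumps is the innermost variable on the left and
  the outermost on the right. Each application of Tonelli moves it out past one jump and replaces
  the horizon T of that jump by t.\<close>

lemma step_pow_occ:
  assumes h: "case_prod h \<in> borel_measurable (borel \<Otimes>\<^sub>M borel)"
  shows "(step T ^^ n) (occ T h) s x = (\<integral>\<^sup>+t. indicator {s..T} t * (step t ^^ n) (no_jump t (h t)) s x \<partial>lborel)"
proof (induction n arbitrary: s x)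
  case 0
  show ?case by (simp add: occ_def no_jump_def ac_simps)
next
  case (Suc n)
  let ?F = "\<lambda>t u y. (step t ^^ n) (no_jump t (h t)) u y"
  note triple_measurable[OF step_pow_measurable_param[OF no_jump_measurable_param[OF h]], measurable (raw)]
  have "(step T ^^ Suc n) (occ T h) s x =
    (\<integral>\<^sup>+u. indicator {s..T} u * ennreal (surv s u x) * (\<integral>\<^sup>+y. \<integral>\<^sup>+t. indicator {u..T} t * ?F t u y \<partial>lborel \<partial>J u x) \<partial>lborel)"
    by (simp add: step_def[of T] Suc.IH)
  also have "\<dots> = (\<integral>\<^sup>+u. indicator {s..T} u * ennreal (surv s u x) * (\<integral>\<^sup>+t. \<integral>\<^sup>+y. indicator {u..T} t * ?F t u y \<partial>J u x \<partial>lborel) \<partial>lborel)"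
  proof (intro nn_integral_cong arg_cong2[where f = "(*)"] refl)
    fix u
    interpret pair_sigma_finite "J u x" lborel by (rule J_lborel)
    show "(\<integral>\<^sup>+y. \<integral>\<^sup>+t. indicator {u..T} t * ?F t u y \<partial>lborel \<partial>J u x) = (\<integral>\<^sup>+t. \<integral>\<^sup>+y. indicator {u..T} t * ?F t u y \<partial>J u x \<partial>lborel)"
      by (rule Fubini'[symmetric]) measurable
  qed
  also have "\<dots> = (\<integral>\<^sup>+u. \<integral>\<^sup>+t. indicator {s..T} u * ennreal (surv s u x) * (indicator {u..T} t * (\<integral>\<^sup>+y. ?F t u y \<partial>J u x)) \<partial>lborel \<partial>lborel)"
    by (simp add: nn_integral_cmult)
  also have "\<dots> = (\<integral>\<^sup>+t. \<integral>\<^sup>+u. indicator {s..T} u * ennreal (surv s u x) * (indicator {u..T} t * (\<integral>\<^sup>+y. ?F t u y \<partial>J u x)) \<partial>lborel \<partial>lborel)"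
    by (rule lborel_pair.Fubini'[symmetric]) measurable
  \<comment> \<open>Both pairs of indicators describe the triangle s \<le> u \<le> t \<le> T; here
    the horizon of the jump changes from T to t.\<close>
  also have "\<dots> = (\<integral>\<^sup>+t. \<integral>\<^sup>+u. indicator {s..T} t * (indicator {s..t} u * ennreal (surv s u x) * (\<integral>\<^sup>+y. ?F t u y \<partial>J u x)) \<partial>lborel \<partial>lborel)"
    by (intro nn_integral_cong) (auto split: split_indicator)
  also have "\<dots> = (\<integral>\<^sup>+t. indicator {s..T} t * (step t ^^ Suc n) (no_jump t (h t)) s x \<partial>lborel)"
    by (simp add: nn_integral_cmult step_def)
  finally show ?case .
qed

text \<open>On indicators this will turn out to be the minimal transition function
  \<open>pmin\<close>. Functions in place of sets make linearity and monotone limits available from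
  the start.\<close>

definition trans_op :: "real \<Rightarrow> ('s \<Rightarrow> ennreal) \<Rightarrow> real \<Rightarrow> 's \<Rightarrow> ennreal" where
  "trans_op t \<phi> s x = pot t (no_jump t \<phi>) s x"

lemma trans_op_measurable:
  assumes "case_prod h \<in> borel_measurable (borel \<Otimes>\<^sub>M borel)"
  shows "(\<lambda>t. trans_op t (h t) s x) \<in> borel_measurable borel"
  unfolding trans_op_def
  by (rule triple_measurable[OF pot_measurable_param[OF no_jump_measurable_param[OF assms]]]) simp_all

lemma pot_occ:
  assumes h: "case_prod h \<in> borel_measurable (borel \<Otimes>\<^sub>M borel)"
  shows "pot T (occ T h) s x = (\<integral>\<^sup>+t. indicator {s..T} t * trans_op t (h t) s x \<partial>lborel)"
proof -
  note triple_measurable[OF step_pow_measurable_param[OF no_jump_measurable_param[OF h]], measurable (raw)]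
  show ?thesis
    unfolding pot_def trans_op_def step_pow_occ[OF h] by (subst nn_integral_suminf[symmetric]) simp_all
qed

lemma trans_op_add:
  assumes "\<phi> \<in> borel_measurable borel" "\<psi> \<in> borel_measurable borel"
  shows "trans_op t (\<lambda>y. \<phi> y + \<psi> y) s x = trans_op t \<phi> s x + trans_op t \<psi> s x"
  unfolding trans_op_def pot_add[OF no_jump_measurable[OF assms(1)] no_jump_measurable[OF assms(2)], symmetric]
  by (simp add: no_jump_def[abs_def] distrib_right)

lemma trans_op_cmult:
  assumes "\<phi> \<in> borel_measurable borel"
  shows "trans_op t (\<lambda>y. c * \<phi> y) s x = c * trans_op t \<phi> s x"
  unfolding trans_op_def pot_cmult[OF no_jump_measurable[OF assms], symmetric]
  by (simp add: no_jump_def[abs_def] mult.assoc)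

lemma trans_op_mono: "(\<And>y. \<phi> y \<le> \<psi> y) \<Longrightarrow> trans_op t \<phi> s x \<le> trans_op t \<psi> s x"
  unfolding trans_op_def by (intro pot_mono) (simp add: no_jump_def mult_right_mono)

lemma trans_op_SUP:
  assumes meas: "\<And>i::nat. F i \<in> borel_measurable borel" and inc: "incseq F"
  shows "trans_op t (\<lambda>y. SUP i. F i y) s x = (SUP i. trans_op t (F i) s x)"
proof -
  have "incseq (\<lambda>i. no_jump t (F i) s x)" for s x
    using inc by (auto simp: incseq_def le_fun_def no_jump_def intro!: mult_right_mono)
  from pot_SUP[OF no_jump_measurable[OF meas] this]
  show ?thesis unfolding trans_op_def by (simp add: no_jump_def[abs_def] SUP_mult_right_ennreal)
qed

text \<open>Equating the two right-hand sides gives Dynkin's formula for \<^term>\<open>\<phi>\<close>. The first comes from splitting off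
  the summand without jumps, the second from \<^prop>\<open>1 = surv s T x + (\<integral>u\<in>{s..T}. surv s u x * lam u x \<partial>lborel)\<close>.\<close>
lemma dynkin:
  assumes [measurable]: "\<phi> \<in> borel_measurable borel"
  shows "pot T (\<lambda>s. \<phi>) s x = \<phi> x + (\<integral>\<^sup>+t. indicator {s..T} t * trans_op t (\<lambda>y. \<integral>\<^sup>+z. \<phi> z \<partial>J t y) s x \<partial>lborel)"
    "pot T (\<lambda>s. \<phi>) s x = trans_op T \<phi> s x + (\<integral>\<^sup>+t. indicator {s..T} t * trans_op t (\<lambda>y. ennreal (lam t y) * \<phi> y) s x \<partial>lborel)"
proof -
  show "pot T (\<lambda>s. \<phi>) s x = \<phi> x + (\<integral>\<^sup>+t. indicator {s..T} t * trans_op t (\<lambda>y. \<integral>\<^sup>+z. \<phi> z \<partial>J t y) s x \<partial>lborel)"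
    by (subst pot_rec, subst step_occ, subst pot_occ) measurable
  have "(\<lambda>s::real. \<phi>) = (\<lambda>s x. no_jump T \<phi> s x + occ T (\<lambda>t y. ennreal (lam t y) * \<phi> y) s x)"
    using surv_const[of \<phi>] by (simp add: fun_eq_iff no_jump_def occ_def)
  then have "pot T (\<lambda>s. \<phi>) s x = pot T (\<lambda>s x. no_jump T \<phi> s x + occ T (\<lambda>t y. ennreal (lam t y) * \<phi> y) s x) s x"
    by simp
  also have "\<dots> = trans_op T \<phi> s x + pot T (occ T (\<lambda>t y. ennreal (lam t y) * \<phi> y)) s x"
    unfolding trans_op_def by (intro pot_add no_jump_measurable occ_measurable) measurable
  finally show "pot T (\<lambda>s. \<phi>) s x = trans_op T \<phi> s x + (\<integral>\<^sup>+t. indicator {s..T} t * trans_op t (\<lambda>y. ennreal (lam t y) * \<phi> y) s x \<partial>lborel)"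
    by (subst (asm) pot_occ) measurable
qed

text \<open>A Gronwall estimate by comparison. As a function of s the right-hand side solves H' =
  -kH - b with value W at T, and the drift condition makes it a supersolution of the backward
  equation. The sign of k is left open because k = -c serves w and k = c' serves w'.\<close>

lemma trans_op_lyapunov:
  fixes W :: "'s \<Rightarrow> real"
  assumes W [measurable]: "W \<in> borel_measurable borel" and W0: "\<And>y. 0 \<le> W y"
    and k: "k \<noteq> 0" and b: "0 \<le> b"
    and drift: "\<And>t y. (\<integral>\<^sup>+z. ennreal (W z) \<partial>J t y) \<le> ennreal ((lam t y + k) * W y + b)"
    and drift0: "\<And>t y. 0 \<le> (lam t y + k) * W y + b"
    and sT: "s \<le> T"
  shows "trans_op T (\<lambda>y. ennreal (W y)) s x \<le> ennreal (exp (k * (T - s)) * W x + b / k * (exp (k * (T - s)) - 1))"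
proof -
  define B where "B v = b / k * (exp (k * (T - v)) - 1)" for v
  define H where "H y v = exp (k * (T - v)) * W y + B v" for v y
  define H' where "H' y v = - exp (k * (T - v)) * (k * W y + b)" for v y
  \<comment> \<open>Time is stopped at T because \<open>pot_le_supersolution\<close> asks for its
    inequality at every s. For s > T the jump integral is empty and both sides equal W.\<close>
  define G where "G v y = ennreal (H y (min v T))" for v y
  have B0: "0 \<le> B v" if "v \<le> T" for v
  proof (cases "k > 0")
    case True
    then show ?thesis using that b by (simp add: B_def)
  next
    case False
    then have "k * (T - v) \<le> 0" using that by (simp add: mult_nonpos_nonneg)
    then have "exp (k * (T - v)) - 1 \<le> 0" by simp
    moreover have "b / k \<le> 0" using False b by (simp add: divide_nonneg_nonpos)
    ultimately show ?thesis unfolding B_def by (rule mult_nonpos_nonpos[rotated])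
  qed
  have der: "(H y has_real_derivative H' y v) (at v)" for y v
    unfolding H_def B_def H'_def using k
    by (auto intro!: derivative_eq_intros simp: field_simps)
  have cont: "continuous_on UNIV (H y)" for y
    using der by (meson DERIV_isCont continuous_at_imp_continuous_on)
  \<comment> \<open>The split matches the two parts of H under \<open>J\<close>: the drift condition
    bounds the integral of the W part by the first summand, and the constant B integrates to the
    second one because \<open>J\<close> has total mass \<open>lam\<close>.\<close>
  have eq: "lam v y * H y v - H' y v = exp (k * (T - v)) * ((lam v y + k) * W y + b) + lam v y * B v" for v y
    by (simp add: H_def H'_def algebra_simps)
  have nonneg: "0 \<le> lam v y * H y v - H' y v" if "v \<le> T" for v y
    unfolding eq using mult_nonneg_nonneg[OF exp_ge_zero drift0] mult_nonneg_nonneg[OF lam_nonneg B0[OF that]]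
    by (rule add_nonneg_nonneg)
  have HT: "H y T = W y" for y by (simp add: H_def B_def)
  have "pot T (no_jump T (\<lambda>y. ennreal (W y))) s x \<le> G s x"
  proof (rule pot_le_supersolution)
    show "case_prod (no_jump T (\<lambda>y. ennreal (W y))) \<in> borel_measurable (borel \<Otimes>\<^sub>M borel)"
      by (rule no_jump_measurable) measurable
    fix s x
    show "no_jump T (\<lambda>y. ennreal (W y)) s x + step T G s x \<le> G s x"
    proof (cases "s \<le> T")
      case True
      have J: "(\<integral>\<^sup>+y. G v y \<partial>J v x) \<le> ennreal (lam v x * H x v - H' x v)" if "v \<le> T" for v
      proof -
        have "(\<integral>\<^sup>+y. G v y \<partial>J v x) = (\<integral>\<^sup>+y. ennreal (exp (k * (T - v))) * ennreal (W y) + ennreal (B v) \<partial>J v x)"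
          unfolding G_def H_def using that B0[OF that] W0
          by (intro nn_integral_cong) (simp add: min_absorb1 ennreal_mult)
        also have "\<dots> = ennreal (exp (k * (T - v))) * (\<integral>\<^sup>+y. ennreal (W y) \<partial>J v x) + ennreal (B v) * ennreal (lam v x)"
          using emeasure_J_UNIV[of v x] sets_eq_imp_space_eq[OF sets_J[of v x]]
          by (simp add: nn_integral_add nn_integral_cmult)
        also have "\<dots> \<le> ennreal (exp (k * (T - v))) * ennreal ((lam v x + k) * W x + b) + ennreal (B v) * ennreal (lam v x)"
          by (intro add_right_mono mult_left_mono drift) auto
        also have "\<dots> = ennreal (lam v x * H x v - H' x v)"
          unfolding eq using drift0 B0[OF that] lam_nonneg
          by (simp add: ennreal_mult[symmetric] ennreal_plus[symmetric] mult.commute del: ennreal_plus)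
        finally show ?thesis .
      qed
      have "step T G s x \<le> (\<integral>\<^sup>+v. indicator {s..T} v * ennreal (surv s v x) * ennreal (lam v x * H x v - H' x v) \<partial>lborel)"
        unfolding step_def using J by (intro nn_integral_mono) (auto intro!: mult_left_mono split: split_indicator)
      then have "no_jump T (\<lambda>y. ennreal (W y)) s x + step T G s x \<le> ennreal (H x T * surv s T x)
         + (\<integral>\<^sup>+v. indicator {s..T} v * ennreal (surv s v x) * ennreal (lam v x * H x v - H' x v) \<partial>lborel)"
        using surv_pos[of s T x] W0[of x] by (intro add_mono) (simp_all add: no_jump_def HT ennreal_mult less_imp_le)
      also have "\<dots> = ennreal (H x s)"
      proof (rule surv_FTC[symmetric, OF True der])
        show "H x \<in> borel_measurable borel" using cont by (rule borel_measurable_continuous_onI)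
        show "H' x \<in> borel_measurable borel" unfolding H'_def by measurable
      qed (use nonneg HT W0 in auto)
      finally show ?thesis using True by (simp add: G_def)
    next
      case False
      then show ?thesis by (simp add: no_jump_def step_def G_def HT min_absorb2)
    qed
  qed
  then show ?thesis using sT by (simp add: trans_op_def G_def H_def B_def min_absorb1)
qed

end

subsection \<open>Integrated rewards under drift conditions\<close>

text \<open>The point mass at the current state is moved to the right, so that a nonnegative
  integral over jumps remains on the left. Nonnegativity of the right-hand sides is a separate
  requirement: \<open>ennreal\<close> sends negative reals to 0, so where \<open>J t y\<close> is
  null the inequality alone would allow them.\<close>

locale lyapunov_rates = jump_rates lam J
  for lam :: "real \<Rightarrow> 's::polish_space \<Rightarrow> real" and J :: "real \<Rightarrow> 's \<Rightarrow> 's measure" +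
  fixes w w' :: "'s \<Rightarrow> real" and c b c' b' M' :: real
  assumes w_meas [measurable]: "w \<in> borel_measurable borel" and w_ge_1: "1 \<le> w y"
    and c: "0 < c" and b: "0 \<le> b"
    and w_drift: "(\<integral>\<^sup>+z. ennreal (w z) \<partial>J t y) \<le> ennreal ((lam t y - c) * w y + b)"
    and w_drift_nonneg: "0 \<le> (lam t y - c) * w y + b"
    and w'_meas [measurable]: "w' \<in> borel_measurable borel" and w'_nonneg: "0 \<le> w' y"
    and c': "0 < c'" and b': "0 \<le> b'"
    and w'_drift: "(\<integral>\<^sup>+z. ennreal (w' z) \<partial>J t y) \<le> ennreal ((lam t y + c') * w' y + b')"
    and w'_drift_nonneg: "0 \<le> (lam t y + c') * w' y + b'"
    and M': "0 < M'" and lam_w: "lam t y * w y \<le> M' * w' y"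
begin

lemma w_nonneg: "0 \<le> w y" using w_ge_1[of y] by simp

text \<open>The negative drift k = -c yields a bound that does not depend on T; this is what makes
  the final-time term disappear after division by T.\<close>

lemma trans_op_w:
  assumes "0 \<le> T"
  shows "trans_op T (\<lambda>y. ennreal (w y)) 0 x \<le> ennreal (w x + b / c)"
proof -
  have e: "exp (- c * T) \<le> 1" using c assms by simp
  have "trans_op T (\<lambda>y. ennreal (w y)) 0 x
    \<le> ennreal (exp (- c * (T - 0)) * w x + b / (- c) * (exp (- c * (T - 0)) - 1))"
    using w_drift w_drift_nonneg c b w_nonneg assms by (intro trans_op_lyapunov) auto
  also have "\<dots> \<le> ennreal (w x + b / c)"
  proof (rule ennreal_leI)
    have "exp (- c * T) * w x \<le> 1 * w x" using e w_nonneg by (intro mult_right_mono) auto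
    moreover have "(b / c) * (1 - exp (- c * T)) \<le> (b / c) * 1"
      using b c by (intro mult_left_mono) auto
    ultimately show "exp (- c * (T - 0)) * w x + b / (- c) * (exp (- c * (T - 0)) - 1) \<le> w x + b / c"
      by (simp add: algebra_simps)
  qed
  finally show ?thesis .
qed

text \<open>By \<open>dynkin(2)\<close> this is the expectation of w at T plus the time integral of
  the expectation of \<lambda>w. The latter is dominated through w', by the constant
  \<open>M' * K\<close> in which K is the estimate of w' at the largest time T.\<close>

lemma pot_w_finite:
  assumes T: "0 \<le> T"
  shows "pot T (\<lambda>s y. ennreal (w y)) 0 x < \<infinity>"
proof -
  define K where "K = exp (c' * T) * w' x + b' / c' * (exp (c' * T) - 1)"
  have "trans_op t (\<lambda>y. ennreal (lam t y) * ennreal (w y)) 0 x \<le> ennreal (M' * K)" if t: "0 \<le> t" "t \<le> T" for t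
  proof -
    have e: "exp (c' * t) \<le> exp (c' * T)" using c' t by simp
    have "trans_op t (\<lambda>y. ennreal (lam t y) * ennreal (w y)) 0 x \<le> trans_op t (\<lambda>y. ennreal M' * ennreal (w' y)) 0 x"
      using lam_w M' w'_nonneg lam_nonneg w_nonneg
      by (intro trans_op_mono) (simp add: ennreal_mult[symmetric] ennreal_leI)
    also have "\<dots> = ennreal M' * trans_op t (\<lambda>y. ennreal (w' y)) 0 x" by (rule trans_op_cmult) measurable
    also have "\<dots> \<le> ennreal M' * ennreal (exp (c' * (t - 0)) * w' x + b' / c' * (exp (c' * (t - 0)) - 1))"
      using w'_drift w'_drift_nonneg c' b' w'_nonneg t by (intro mult_left_mono trans_op_lyapunov) auto
    also have "\<dots> \<le> ennreal M' * ennreal K"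
      unfolding K_def using e c' b' w'_nonneg[of x]
      by (intro mult_left_mono ennreal_leI add_mono mult_right_mono mult_left_mono) auto
    also have "\<dots> = ennreal (M' * K)"
      using M' by (simp add: ennreal_mult')
    finally show ?thesis .
  qed
  then have "(\<integral>\<^sup>+t. indicator {0..T} t * trans_op t (\<lambda>y. ennreal (lam t y) * ennreal (w y)) 0 x \<partial>lborel)
    \<le> (\<integral>\<^sup>+t. ennreal (M' * K) * indicator {0..T} t \<partial>lborel)"
    by (intro nn_integral_mono) (auto split: split_indicator)
  also have "\<dots> < \<infinity>" using T by (simp add: nn_integral_cmult_indicator ennreal_mult_less_top)
  finally show ?thesis
    using le_less_trans[OF trans_op_w[OF T, of x] ennreal_less_top] by (simp add: dynkin(2))
qed

text \<open>Because \<open>J\<close> has total mass \<open>lam\<close>, the two integrals in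
  Dynkin's formula for the function 1 are the same number. It is finite since 1 \<le> w, and so it
  cancels.\<close>

lemma trans_op_one:
  assumes "0 \<le> T"
  shows "trans_op T (\<lambda>y. 1) 0 x = 1"
proof -
  have "pot T (\<lambda>s y. 1) 0 x \<le> pot T (\<lambda>s y. ennreal (w y)) 0 x"
    using w_ge_1 by (intro pot_mono) simp
  with pot_w_finite[OF assms] have fin: "pot T (\<lambda>s y. 1) 0 x < \<infinity>" by (rule le_less_trans[rotated])
  let ?I = "\<integral>\<^sup>+t. indicator {0..T} t * trans_op t (\<lambda>y. ennreal (lam t y)) 0 x \<partial>lborel"
  have J1: "emeasure (J t y) (space (J t y)) = ennreal (lam t y)" for t y
    using emeasure_J_UNIV[of t y] sets_eq_imp_space_eq[OF sets_J[of t y]] by simp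
  have 1: "pot T (\<lambda>s y. 1) 0 x = 1 + ?I" using dynkin(1)[of "\<lambda>y. 1" T 0 x] by (simp add: J1)
  have 2: "pot T (\<lambda>s y. 1) 0 x = trans_op T (\<lambda>y. 1) 0 x + ?I" using dynkin(2)[of "\<lambda>y. 1" T 0 x] by simp
  have "?I \<noteq> \<infinity>" using fin 1 by auto
  moreover have "?I + trans_op T (\<lambda>y. 1) 0 x = ?I + 1"
    using trans[OF 2[symmetric] 1] by (simp only: add.commute)
  ultimately show ?thesis by (simp only: ennreal_add_left_cancel) simp
qed

text \<open>Monotone, and additive on measurable integrands, with no integrability condition: an
  inequality between rates can be integrated along the process before anything is cancelled.\<close>

definition occ_int :: "'s \<Rightarrow> real \<Rightarrow> (real \<Rightarrow> 's \<Rightarrow> ennreal) \<Rightarrow> ennreal" where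
  "occ_int x T h = (\<integral>\<^sup>+t. indicator {0..T} t * trans_op t (h t) 0 x \<partial>lborel)"

lemma occ_int_mono:
  "(\<And>t y. 0 \<le> t \<Longrightarrow> t \<le> T \<Longrightarrow> h t y \<le> h' t y) \<Longrightarrow> occ_int x T h \<le> occ_int x T h'"
  unfolding occ_int_def by (intro nn_integral_mono) (auto intro!: trans_op_mono split: split_indicator)

lemma occ_int_add:
  assumes h: "case_prod h \<in> borel_measurable (borel \<Otimes>\<^sub>M borel)"
    and h': "case_prod h' \<in> borel_measurable (borel \<Otimes>\<^sub>M borel)"
  shows "occ_int x T (\<lambda>t y. h t y + h' t y) = occ_int x T h + occ_int x T h'"
proof -
  note [measurable] = h h' trans_op_measurable[OF h] trans_op_measurable[OF h']
  have "trans_op t (\<lambda>y. h t y + h' t y) 0 x = trans_op t (h t) 0 x + trans_op t (h' t) 0 x" for t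
    by (rule trans_op_add) measurable
  then show ?thesis
    unfolding occ_int_def by (simp add: distrib_left nn_integral_add)
qed

lemma occ_int_const:
  assumes "0 \<le> T"
  shows "occ_int x T (\<lambda>t y. k) = k * ennreal T"
proof -
  have "trans_op t (\<lambda>y. k) 0 x = k" if "0 \<le> t" for t
    using trans_op_cmult[of "\<lambda>y. 1" t k 0 x] trans_op_one[OF that, of x] by simp
  then have "occ_int x T (\<lambda>t y. k) = (\<integral>\<^sup>+t. k * indicator {0..T} t \<partial>lborel)"
    unfolding occ_int_def by (intro nn_integral_cong) (auto split: split_indicator)
  then show ?thesis using assms by (simp add: nn_integral_cmult_indicator)
qed

text \<open>The bridge from the Bochner integrals of the criterion to nonnegative quantities. Since
  \<open>ennreal\<close> keeps only the positive part, \<rho> and -\<rho> produce the two parts; the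
  weight bound makes both integrable in state and time, so they may be subtracted.\<close>

lemma integral_eq_occ_int:
  fixes \<rho> :: "real \<Rightarrow> 's \<Rightarrow> real" and \<mu> :: "real \<Rightarrow> 's measure"
  assumes \<rho> [measurable]: "case_prod \<rho> \<in> borel_measurable (borel \<Otimes>\<^sub>M borel)"
    and bound: "\<And>t y. \<bar>\<rho> t y\<bar> \<le> M * w y" and M: "0 \<le> M" and T: "0 \<le> T"
    and sets_\<mu>: "\<And>t. 0 \<le> t \<Longrightarrow> sets (\<mu> t) = sets borel"
    and \<mu>: "\<And>t \<phi>. 0 \<le> t \<Longrightarrow> \<phi> \<in> borel_measurable borel \<Longrightarrow> (\<integral>\<^sup>+y. \<phi> y \<partial>\<mu> t) = trans_op t \<phi> 0 x"
  shows "occ_int x T (\<lambda>t y. ennreal (\<rho> t y)) < \<infinity>"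
    and "(LINT t:{0..T}|lborel. \<integral>y. \<rho> t y \<partial>\<mu> t) =
      enn2real (occ_int x T (\<lambda>t y. ennreal (\<rho> t y))) - enn2real (occ_int x T (\<lambda>t y. ennreal (- \<rho> t y)))"
proof -
  have trans_op_fin: "trans_op t (\<lambda>y. ennreal (\<sigma> t y)) 0 x \<le> ennreal (M * (w x + b / c))"
    if "\<And>t y. \<bar>\<sigma> t y\<bar> \<le> M * w y" "0 \<le> t" for t and \<sigma> :: "real \<Rightarrow> 's \<Rightarrow> real"
  proof -
    have "trans_op t (\<lambda>y. ennreal (\<sigma> t y)) 0 x \<le> trans_op t (\<lambda>y. ennreal M * ennreal (w y)) 0 x"
      using order_trans[OF abs_ge_self that(1)] M w_nonneg
      by (intro trans_op_mono) (simp add: ennreal_mult[symmetric] ennreal_leI)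
    also have "\<dots> = ennreal M * trans_op t (\<lambda>y. ennreal (w y)) 0 x" by (rule trans_op_cmult) measurable
    also have "\<dots> \<le> ennreal M * ennreal (w x + b / c)" by (intro mult_left_mono trans_op_w that) auto
    also have "\<dots> = ennreal (M * (w x + b / c))"
      using M by (simp add: ennreal_mult')
    finally show ?thesis .
  qed
  have occ_fin: "occ_int x T (\<lambda>t y. ennreal (\<sigma> t y)) < \<infinity>"
    if "\<And>t y. \<bar>\<sigma> t y\<bar> \<le> M * w y" for \<sigma> :: "real \<Rightarrow> 's \<Rightarrow> real"
  proof -
    have "occ_int x T (\<lambda>t y. ennreal (\<sigma> t y)) \<le> (\<integral>\<^sup>+t. ennreal (M * (w x + b / c)) * indicator {0..T} t \<partial>lborel)"
      unfolding occ_int_def using trans_op_fin[of \<sigma>] that by (intro nn_integral_mono) (auto split: split_indicator)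
    also have "\<dots> < \<infinity>" using T by (simp add: nn_integral_cmult_indicator ennreal_mult_less_top)
    finally show ?thesis .
  qed
  show "occ_int x T (\<lambda>t y. ennreal (\<rho> t y)) < \<infinity>" by (rule occ_fin[OF bound])
  define e where "e \<sigma> t = indicat_real {0..T} t * enn2real (trans_op t (\<lambda>y. ennreal (\<sigma> t y)) 0 x)" for \<sigma> t
  have e: "integrable lborel (e \<sigma>) \<and> integral\<^sup>L lborel (e \<sigma>) = enn2real (occ_int x T (\<lambda>t y. ennreal (\<sigma> t y)))"
    if [measurable]: "case_prod \<sigma> \<in> borel_measurable (borel \<Otimes>\<^sub>M borel)"
      and bd: "\<And>t y. \<bar>\<sigma> t y\<bar> \<le> M * w y" for \<sigma>
  proof -
    have [measurable]: "(\<lambda>t. trans_op t (\<lambda>y. ennreal (\<sigma> t y)) 0 x) \<in> borel_measurable borel"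
      by (rule trans_op_measurable) measurable
    have [measurable]: "e \<sigma> \<in> borel_measurable borel" unfolding e_def by measurable
    \<comment> \<open>\<open>enn2real\<close> would turn an infinite expectation into 0;
      \<open>trans_op_fin\<close> excludes this on [0,T].\<close>
    have nn: "(\<integral>\<^sup>+t. ennreal (e \<sigma> t) \<partial>lborel) = occ_int x T (\<lambda>t y. ennreal (\<sigma> t y))"
      unfolding occ_int_def e_def
    proof (intro nn_integral_cong)
      fix t
      show "ennreal (indicat_real {0..T} t * enn2real (trans_op t (\<lambda>y. ennreal (\<sigma> t y)) 0 x))
        = indicator {0..T} t * trans_op t (\<lambda>y. ennreal (\<sigma> t y)) 0 x"
        using le_less_trans[OF trans_op_fin[of \<sigma> t, OF bd] ennreal_less_top] by (auto split: split_indicator)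
    qed
    have "integrable lborel (e \<sigma>)"
      using occ_fin[of \<sigma>, OF bd] nn by (intro integrableI_nonneg) (auto simp: e_def)
    moreover have "integral\<^sup>L lborel (e \<sigma>) = enn2real (\<integral>\<^sup>+t. ennreal (e \<sigma> t) \<partial>lborel)"
      by (rule integral_eq_nn_integral) (auto simp: e_def[abs_def])
    ultimately show ?thesis using nn by simp
  qed
  have "(\<integral>y. \<rho> t y \<partial>\<mu> t) = enn2real (trans_op t (\<lambda>y. ennreal (\<rho> t y)) 0 x) - enn2real (trans_op t (\<lambda>y. ennreal (- \<rho> t y)) 0 x)"
    if t: "0 \<le> t" for t
  proof -
    note [measurable_cong] = sets_\<mu>[OF t]
    have "integrable (\<mu> t) (\<rho> t)"
    proof (rule integrableI_bounded)
      show "\<rho> t \<in> borel_measurable (\<mu> t)" by measurable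
      have "(\<integral>\<^sup>+y. ennreal (norm (\<rho> t y)) \<partial>\<mu> t) = trans_op t (\<lambda>y. ennreal (\<bar>\<rho> t y\<bar>)) 0 x"
        using \<mu>[OF t, of "\<lambda>y. ennreal \<bar>\<rho> t y\<bar>"] by simp
      also have "\<dots> < \<infinity>"
        using le_less_trans[OF trans_op_fin[of "\<lambda>t y. \<bar>\<rho> t y\<bar>", OF _ t] ennreal_less_top] bound by simp
      finally show "(\<integral>\<^sup>+y. ennreal (norm (\<rho> t y)) \<partial>\<mu> t) < \<infinity>" .
    qed
    then show ?thesis
      using \<mu>[OF t, of "\<lambda>y. ennreal (\<rho> t y)"] \<mu>[OF t, of "\<lambda>y. ennreal (- \<rho> t y)"]
      by (simp add: real_lebesgue_integral_def)
  qed
  then have "(LINT t:{0..T}|lborel. \<integral>y. \<rho> t y \<partial>\<mu> t) = (LINT t|lborel. e \<rho> t - e (\<lambda>t y. - \<rho> t y) t)"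
    unfolding set_lebesgue_integral_def e_def by (intro Bochner_Integration.integral_cong) (auto split: split_indicator)
  also have "\<dots> = integral\<^sup>L lborel (e \<rho>) - integral\<^sup>L lborel (e (\<lambda>t y. - \<rho> t y))"
    using e[of \<rho>] e[of "\<lambda>t y. - \<rho> t y"] bound by (intro Bochner_Integration.integral_diff) auto
  finally show "(LINT t:{0..T}|lborel. \<integral>y. \<rho> t y \<partial>\<mu> t) =
      enn2real (occ_int x T (\<lambda>t y. ennreal (\<rho> t y))) - enn2real (occ_int x T (\<lambda>t y. ennreal (- \<rho> t y)))"
    using e[of \<rho>] e[of "\<lambda>t y. - \<rho> t y"] bound by simp
qed

lemma J_integrable:
  assumes [measurable]: "u \<in> borel_measurable borel" and u: "\<And>y. \<bar>u y\<bar> \<le> C * w y"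
  shows "integrable (J t y) u"
proof (rule integrableI_bounded)
  have C: "0 \<le> C" using u[of y] w_ge_1[of y] by (smt (verit) mult_nonneg_nonneg zero_le_mult_iff)
  have "(\<integral>\<^sup>+z. ennreal (norm (u z)) \<partial>J t y) \<le> (\<integral>\<^sup>+z. ennreal C * ennreal (w z) \<partial>J t y)"
    using u C w_nonneg by (intro nn_integral_mono) (simp add: ennreal_mult[symmetric] ennreal_leI)
  also have "\<dots> \<le> ennreal C * ennreal ((lam t y - c) * w y + b)"
    by (simp add: nn_integral_cmult mult_left_mono w_drift)
  also have "\<dots> < \<infinity>" by (simp add: ennreal_mult_less_top)
  finally show "(\<integral>\<^sup>+z. ennreal (norm (u z)) \<partial>J t y) < \<infinity>" .
qed measurable

text \<open>The pointwise inequality is integrated along the process, and Dynkin's formula for the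
  two parts of u removes the generator terms. All that is left of u is its value at x and its
  expectation at T, the latter bounded by C(w(x) + b/c).\<close>

lemma integrated_reward_le:
  fixes \<rho> :: "real \<Rightarrow> 's \<Rightarrow> real" and \<mu> :: "real \<Rightarrow> 's measure"
  assumes \<rho> [measurable]: "case_prod \<rho> \<in> borel_measurable (borel \<Otimes>\<^sub>M borel)"
    and bound: "\<And>t y. \<bar>\<rho> t y\<bar> \<le> M * w y" and M: "0 \<le> M" and T: "0 \<le> T"
    and sets_\<mu>: "\<And>t. 0 \<le> t \<Longrightarrow> sets (\<mu> t) = sets borel"
    and \<mu>: "\<And>t \<phi>. 0 \<le> t \<Longrightarrow> \<phi> \<in> borel_measurable borel \<Longrightarrow> (\<integral>\<^sup>+y. \<phi> y \<partial>\<mu> t) = trans_op t \<phi> 0 x"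
    and u_meas [measurable]: "u \<in> borel_measurable borel" and u: "\<And>y. \<bar>u y\<bar> \<le> C * w y" and C: "0 \<le> C"
    and g: "\<And>t y. 0 \<le> t \<Longrightarrow> \<rho> t y + (\<integral>z. u z \<partial>J t y) - lam t y * u y \<le> g"
  shows "(LINT t:{0..T}|lborel. \<integral>y. \<rho> t y \<partial>\<mu> t) \<le> g * T + (\<bar>u x\<bar> + C * (w x + b / c))"
proof -
  \<comment> \<open>Gain and loss terms of the generator on the positive part of f, since
    \<open>ennreal\<close> cuts off negative values. The negative part of u is reached through
    \<open>?un\<close>.\<close>
  define Jf where "Jf f t y = (\<integral>\<^sup>+z. ennreal (f z) \<partial>J t y)" for f t y
  define Lf where "Lf f t y = ennreal (lam t y) * ennreal (f y)" for f :: "'s \<Rightarrow> real" and t y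
  let ?un = "\<lambda>y. - u y" and ?\<rho>p = "\<lambda>t y. ennreal (\<rho> t y)" and ?\<rho>n = "\<lambda>t y. ennreal (- \<rho> t y)"
  have [measurable]: "case_prod (Jf f) \<in> borel_measurable (borel \<Otimes>\<^sub>M borel)"
    "case_prod (Lf f) \<in> borel_measurable (borel \<Otimes>\<^sub>M borel)"
    if [measurable]: "f \<in> borel_measurable borel" for f unfolding Jf_def Lf_def by measurable
  \<comment> \<open>The hypothesis with every negative part moved across: all eight summands are
    nonnegative and can be integrated one by one.\<close>
  have pointwise: "?\<rho>p t y + Jf u t y + Lf ?un t y + ennreal (- g) \<le> ennreal g + ?\<rho>n t y + Jf ?un t y + Lf u t y"
    if t: "0 \<le> t" for t y
  proof -
    have fin: "Jf f t y < \<infinity>" if "f = u \<or> f = ?un" for f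
    proof -
      have "integrable (J t y) f" using that u by (intro J_integrable) auto
      then show ?thesis unfolding Jf_def real_integrable_def by (simp add: less_top)
    qed
    define j1 j2 where "j1 = enn2real (Jf u t y)" and "j2 = enn2real (Jf ?un t y)"
    have j: "Jf u t y = ennreal j1" "Jf ?un t y = ennreal j2" "0 \<le> j1" "0 \<le> j2"
      using fin by (auto simp: j1_def j2_def)
    have "(\<integral>z. u z \<partial>J t y) = j1 - j2"
      using J_integrable[OF u_meas u] by (simp add: real_lebesgue_integral_def j1_def j2_def Jf_def)
    with g[OF t, of y] have *: "\<rho> t y + j1 - j2 - lam t y * u y \<le> g" by simp
    have L: "Lf f t y = ennreal (lam t y * max 0 (f y))" for f
      using lam_nonneg by (simp add: Lf_def ennreal_mult' max_def ennreal_neg)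
    have lu: "lam t y * u y = lam t y * max 0 (u y) - lam t y * max 0 (- u y)"
      by (simp add: max_def)
    have e: "ennreal r = ennreal (max 0 r)" for r by (simp add: max_def ennreal_neg)
    have n: "0 \<le> lam t y * max 0 (f y)" for f using lam_nonneg by simp
    have le: "ennreal (max 0 (\<rho> t y) + j1 + lam t y * max 0 (- u y) + max 0 (- g))
      \<le> ennreal (max 0 g + max 0 (- \<rho> t y) + j2 + lam t y * max 0 (u y))"
    proof (intro ennreal_leI)
      define rp rn gp gn where "rp = max 0 (\<rho> t y)" and "rn = max 0 (- \<rho> t y)"
        and "gp = max 0 g" and "gn = max 0 (- g)"
      have "\<rho> t y = rp - rn" "g = gp - gn" by (simp_all add: rp_def rn_def gp_def gn_def max_def)
      moreover define up un where "up = lam t y * max 0 (u y)" and "un = lam t y * max 0 (- u y)"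
      ultimately have "rp + j1 + un + gn \<le> gp + rn + j2 + up"
        using * lu by linarith
      then show "max 0 (\<rho> t y) + j1 + lam t y * max 0 (- u y) + max 0 (- g)
        \<le> max 0 g + max 0 (- \<rho> t y) + j2 + lam t y * max 0 (u y)"
        unfolding rp_def rn_def gp_def gn_def up_def un_def .
    qed
    have "?\<rho>p t y + Jf u t y + Lf ?un t y + ennreal (- g) = ennreal (max 0 (\<rho> t y) + j1 + lam t y * max 0 (- u y) + max 0 (- g))"
      unfolding j(1) L e[of "\<rho> t y"] e[of "- g"] using j(3) n[of ?un] by simp
    moreover have "ennreal g + ?\<rho>n t y + Jf ?un t y + Lf u t y = ennreal (max 0 g + max 0 (- \<rho> t y) + j2 + lam t y * max 0 (u y))"
      unfolding j(2) L e[of "- \<rho> t y"] e[of g] using j(4) n[of u] by simp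
    ultimately show ?thesis using le by (simp only:)
  qed
  let ?I = "occ_int x T"
  have "?I (\<lambda>t y. ?\<rho>p t y + Jf u t y + Lf ?un t y + ennreal (- g))
    \<le> ?I (\<lambda>t y. ennreal g + ?\<rho>n t y + Jf ?un t y + Lf u t y)"
    by (intro occ_int_mono pointwise)
  also have "?I (\<lambda>t y. ?\<rho>p t y + Jf u t y + Lf ?un t y + ennreal (- g))
    = ?I ?\<rho>p + ?I (Jf u) + ?I (Lf ?un) + ennreal (- g) * ennreal T"
    using T by (subst occ_int_add, measurable)+ (simp add: occ_int_const)
  also have "?I (\<lambda>t y. ennreal g + ?\<rho>n t y + Jf ?un t y + Lf u t y)
    = ennreal g * ennreal T + ?I ?\<rho>n + ?I (Jf ?un) + ?I (Lf u)"
    using T by (subst occ_int_add, measurable)+ (simp add: occ_int_const)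
  finally have ineq: "?I ?\<rho>p + ?I (Jf u) + ?I (Lf ?un) + ennreal (- g) * ennreal T
    \<le> ennreal g * ennreal T + ?I ?\<rho>n + ?I (Jf ?un) + ?I (Lf u)" .
  \<comment> \<open>Dynkin's formula for the positive part of f with all terms finite, where p is
    its expectation at T. It is applied to u and to -u.\<close>
  have dyn: "\<exists>j l p. ?I (Jf f) = ennreal j \<and> ?I (Lf f) = ennreal l \<and> 0 \<le> j \<and> 0 \<le> l \<and> 0 \<le> p
      \<and> max 0 (f x) + j = p + l \<and> p \<le> C * (w x + b / c)"
    if [measurable]: "f \<in> borel_measurable borel" and f: "\<And>y. \<bar>f y\<bar> \<le> C * w y" for f
  proof -
    have le: "ennreal (f y) \<le> ennreal C * ennreal (w y)" for y
      using f[of y] C w_nonneg[of y] by (simp add: ennreal_mult[symmetric] ennreal_leI)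
    define P where "P = trans_op T (\<lambda>y. ennreal (f y)) 0 x"
    have "pot T (\<lambda>s y. ennreal (f y)) 0 x \<le> pot T (\<lambda>s y. ennreal C * ennreal (w y)) 0 x"
      by (intro pot_mono le)
    also have "\<dots> = ennreal C * pot T (\<lambda>s y. ennreal (w y)) 0 x" by (rule pot_cmult) measurable
    also have "\<dots> < \<infinity>" using pot_w_finite[OF T, of x] by (simp add: ennreal_mult_less_top)
    finally have fin: "pot T (\<lambda>s y. ennreal (f y)) 0 x < \<infinity>" .
    have 1: "pot T (\<lambda>s y. ennreal (f y)) 0 x = ennreal (f x) + ?I (Jf f)"
      unfolding occ_int_def Jf_def by (rule dynkin) measurable
    have 2: "pot T (\<lambda>s y. ennreal (f y)) 0 x = P + ?I (Lf f)"
      unfolding occ_int_def Lf_def P_def by (rule dynkin) measurable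
    have "P \<le> trans_op T (\<lambda>y. ennreal C * ennreal (w y)) 0 x" unfolding P_def by (intro trans_op_mono le)
    also have "\<dots> = ennreal C * trans_op T (\<lambda>y. ennreal (w y)) 0 x" by (rule trans_op_cmult) measurable
    also have "\<dots> \<le> ennreal C * ennreal (w x + b / c)" by (intro mult_left_mono trans_op_w T) auto
    also have "\<dots> = ennreal (C * (w x + b / c))" using C by (simp add: ennreal_mult')
    finally have P: "P \<le> ennreal (C * (w x + b / c))" .
    have fins: "?I (Jf f) \<noteq> \<infinity>" "?I (Lf f) \<noteq> \<infinity>" "P \<noteq> \<infinity>"
      using fin[unfolded 1] fin[unfolded 2] by auto
    obtain j where j: "?I (Jf f) = ennreal j" "0 \<le> j" using fins(1) by (cases "?I (Jf f)") auto
    obtain l where l: "?I (Lf f) = ennreal l" "0 \<le> l" using fins(2) by (cases "?I (Lf f)") auto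
    obtain p where p: "P = ennreal p" "0 \<le> p" using fins(3) by (cases P) auto
    note jlp = j(1) l(1) p(1) j(2) l(2) p(2)
    have "ennreal (f x) + ennreal j = ennreal p + ennreal l"
      using 1 2 unfolding jlp(1-3) by (rule trans[OF sym])
    then have "ennreal (max 0 (f x) + j) = ennreal (p + l)"
      using jlp(4-6) by (cases "0 \<le> f x") (simp_all add: max_def ennreal_neg)
    then have "max 0 (f x) + j = p + l" using jlp by (subst (asm) ennreal_inj) auto
    moreover have "p \<le> C * (w x + b / c)"
      using P jlp C w_nonneg[of x] b c by (simp add: ennreal_le_iff)
    ultimately show ?thesis using jlp by blast
  qed
  from dyn[OF u_meas u] obtain j1 l1 p1 where 1: "?I (Jf u) = ennreal j1" "?I (Lf u) = ennreal l1"
    "0 \<le> j1" "0 \<le> l1" "0 \<le> p1" "max 0 (u x) + j1 = p1 + l1" "p1 \<le> C * (w x + b / c)" by blast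
  have un_meas: "?un \<in> borel_measurable borel" and un: "\<bar>?un y\<bar> \<le> C * w y" for y
    using u[of y] by simp_all
  from dyn[OF un_meas un] obtain j2 l2 p2 where 2: "?I (Jf ?un) = ennreal j2" "?I (Lf ?un) = ennreal l2"
    "0 \<le> j2" "0 \<le> l2" "0 \<le> p2" "max 0 (- u x) + j2 = p2 + l2" "p2 \<le> C * (w x + b / c)" by blast
  define a1 a2 where "a1 = enn2real (?I ?\<rho>p)" and "a2 = enn2real (?I ?\<rho>n)"
  have neg_meas: "(\<lambda>(t, y). - \<rho> t y) \<in> borel_measurable (borel \<Otimes>\<^sub>M borel)" by measurable
  have neg_bound: "\<bar>- \<rho> t y\<bar> \<le> M * w y" for t y using bound[of t y] by simp
  have "?I ?\<rho>p < \<infinity>" by (rule integral_eq_occ_int(1)[OF \<rho> bound M T sets_\<mu> \<mu>])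
  moreover have "?I ?\<rho>n < \<infinity>" by (rule integral_eq_occ_int(1)[OF neg_meas neg_bound M T sets_\<mu> \<mu>])
  ultimately have a: "?I ?\<rho>p = ennreal a1" "?I ?\<rho>n = ennreal a2" "0 \<le> a1" "0 \<le> a2"
    by (simp_all add: a1_def a2_def)
  have gT: "ennreal r * ennreal T = ennreal (max 0 r * T)" for r
    using T by (simp add: ennreal_mult' max_def ennreal_neg)
  have gT0: "0 \<le> max 0 r * T" for r using T by simp
  have "ennreal (a1 + j1 + l2 + max 0 (- g) * T) \<le> ennreal (max 0 g * T + a2 + j2 + l1)"
    using ineq unfolding gT a(1,2) 1(1,2) 2(1,2)
    using a(3,4) 1(3-5) 2(3-5) gT0[of g] gT0[of "- g"] by simp
  then have "a1 + j1 + l2 + max 0 (- g) * T \<le> max 0 g * T + a2 + j2 + l1"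
    by (rule ennreal_le_iff[THEN iffD1, rotated]) (use a(3,4) 1(3-5) 2(3-5) gT0[of g] in simp)
  moreover have "max 0 g * T - max 0 (- g) * T = g * T" by (simp add: max_def)
  \<comment> \<open>Eliminating j1, l1, j2 and l2 by the two Dynkin identities leaves a1 - a2 \<le>
    g T + u x + p2 - p1; it remains to use p1 \<ge> 0 and the bound on p2.\<close>
  ultimately have "a1 - a2 \<le> g * T + (\<bar>u x\<bar> + C * (w x + b / c))"
    using 1 2 by linarith
  moreover have "(LINT t:{0..T}|lborel. \<integral>y. \<rho> t y \<partial>\<mu> t) = a1 - a2"
    unfolding a1_def a2_def by (rule integral_eq_occ_int(2)[OF \<rho> bound M T sets_\<mu> \<mu>])
  ultimately show ?thesis by (simp only:)
qed

end

subsection \<open>Averaged rates of a Markov policy\<close>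

text \<open>Rounding t down to a multiple of 1/(n+1) leaves countably many sections, each
  measurable; continuity in t recovers f in the limit.\<close>

lemma caratheodory_measurable:
  fixes f :: "real \<Rightarrow> 'x \<Rightarrow> real"
  assumes meas [measurable]: "\<And>t. f t \<in> borel_measurable N" and cont: "\<And>x. continuous_on UNIV (\<lambda>t. f t x)"
  shows "(\<lambda>(t, x). f t x) \<in> borel_measurable (borel \<Otimes>\<^sub>M N)"
proof (rule borel_measurable_LIMSEQ_real)
  let ?d = "\<lambda>n t. real_of_int \<lfloor>real (Suc n) * t\<rfloor> / real (Suc n)"
  fix z :: "real \<times> 'x" assume "z \<in> space (borel \<Otimes>\<^sub>M N)"
  obtain t x where z: "z = (t, x)" by (cases z)
  have "(\<lambda>n. ?d n t - t) \<longlonglongrightarrow> 0"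
  proof (rule Lim_null_comparison)
    show "\<forall>\<^sub>F n in sequentially. norm (?d n t - t) \<le> 1 / real (Suc n)"
    proof (intro always_eventually allI)
      fix n
      have "?d n t - t = (real_of_int \<lfloor>real (Suc n) * t\<rfloor> - real (Suc n) * t) / real (Suc n)"
        by (simp add: diff_divide_distrib)
      moreover have "\<bar>real_of_int \<lfloor>real (Suc n) * t\<rfloor> - real (Suc n) * t\<bar> \<le> 1" by linarith
      ultimately show "norm (?d n t - t) \<le> 1 / real (Suc n)"
        by (simp only: real_norm_def abs_divide abs_of_nat divide_right_mono of_nat_0_le_iff)
    qed
    show "(\<lambda>n. 1 / real (Suc n)) \<longlonglongrightarrow> 0"
      using LIMSEQ_inverse_real_of_nat by (simp add: inverse_eq_divide)
  qed
  then have "(\<lambda>n. ?d n t) \<longlonglongrightarrow> t" by (simp only: LIM_zero_iff)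
  moreover have "isCont (\<lambda>t. f t x) t" using cont by (simp add: continuous_on_eq_continuous_at)
  ultimately show "(\<lambda>n. case z of (t, x) \<Rightarrow> f (?d n t) x) \<longlonglongrightarrow> (case z of (t, x) \<Rightarrow> f t x)"
    unfolding z prod.case by (rule isCont_tendsto_compose[rotated])
next
  fix n
  have [measurable]: "(\<lambda>z :: real \<times> 'x. \<lfloor>real (Suc n) * fst z\<rfloor>) \<in> measurable (borel \<Otimes>\<^sub>M N) (count_space UNIV)"
    by measurable
  have "(\<lambda>z. f (real_of_int \<lfloor>real (Suc n) * fst z\<rfloor> / real (Suc n)) (snd z)) \<in> borel_measurable (borel \<Otimes>\<^sub>M N)"
    by (rule measurable_compose_countable[where g = "\<lambda>z. \<lfloor>real (Suc n) * fst z\<rfloor>"]) measurable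
  then show "(\<lambda>(t, x). f (real_of_int \<lfloor>real (Suc n) * t\<rfloor> / real (Suc n)) x) \<in> borel_measurable (borel \<Otimes>\<^sub>M N)"
    by (simp add: case_prod_beta')
qed

lemma signed_measure_on_empty:
  assumes "signed_measure_on Q"
  shows "Q {} = 0"
proof -
  have "(\<lambda>n::nat. Q {}) sums Q {}"
    using assms[unfolded signed_measure_on_def, rule_format, of "\<lambda>n. {}"] by (simp add: disjoint_family_on_def)
  then show ?thesis by (metis sums_iff summable_const_iff)
qed

lemma signed_measure_on_Un:
  assumes Q: "signed_measure_on Q" and "D \<in> sets borel" "E \<in> sets borel" "D \<inter> E = {}"
  shows "Q (D \<union> E) = Q D + Q E"
proof -
  have "disjoint_family (binaryset D E)" using assms(4) by (auto simp: disjoint_family_on_def binaryset_def)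
  then have "(\<lambda>n. Q (binaryset D E n)) sums Q (D \<union> E)"
    using Q[unfolded signed_measure_on_def, rule_format, of "binaryset D E"] assms(2,3)
    by (simp add: range_binaryset_eq UN_binaryset_eq)
  moreover have "(\<lambda>n. Q (binaryset D E n)) sums (Q D + Q E)"
    by (intro binaryset_sums signed_measure_on_empty[OF Q])
  ultimately show ?thesis by (rule sums_unique2)
qed

lemma sets_jump_meas [simp]: "sets (jump_meas x Q) = sets borel"
proof -
  have "sigma_sets UNIV (sets borel) = sets (borel :: 'a measure)"
    using sets.sigma_sets_eq[of "borel :: 'a measure"] by simp
  then show ?thesis by (simp add: jump_meas_def)
qed

locale ctmdp =
  fixes A :: "'s::polish_space \<Rightarrow> 'a::polish_space set"
    and q :: "'s \<Rightarrow> 'a \<Rightarrow> 's set \<Rightarrow> real"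
    and r :: "'s \<Rightarrow> 'a \<Rightarrow> real"
    and \<pi> :: "real \<Rightarrow> 's \<Rightarrow> 'a measure"
  assumes model: "ctmdp_model A q r"
    and pol: "\<pi> \<in> admissible_policies A"
begin

lemma K_meas [measurable]: "Kset A \<in> sets (borel \<Otimes>\<^sub>M borel)"
  using model unfolding borel_prod ctmdp_model_def by blast

lemma A_meas [measurable]: "A x \<in> sets borel"
  using model by (simp add: ctmdp_model_def)

lemma signed: "a \<in> A x \<Longrightarrow> signed_measure_on (q x a)"
  using model by (simp add: ctmdp_model_def)

lemma q_UNIV: "a \<in> A x \<Longrightarrow> q x a UNIV = 0"
  using model by (simp add: ctmdp_model_def)

lemma q_nonneg: "a \<in> A x \<Longrightarrow> D \<in> sets borel \<Longrightarrow> x \<notin> D \<Longrightarrow> 0 \<le> q x a D"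
  using model by (simp add: ctmdp_model_def)

lemma q_compl:
  assumes "a \<in> A x" "D \<in> sets borel"
  shows "q x a (- D) = - q x a D"
  using signed_measure_on_Un[OF signed[OF assms(1)] assms(2), of "- D"] assms q_UNIV[OF assms(1)]
  by (simp add: Compl_eq_Diff_UNIV)

lemma q_diff_le:
  assumes "a \<in> A x" "D \<in> sets borel"
  shows "q x a (D - {x}) \<le> - q x a {x}"
proof -
  have "q x a ((D - {x}) \<union> (- {x} - D)) = q x a (D - {x}) + q x a (- {x} - D)"
    using assms by (intro signed_measure_on_Un signed) auto
  moreover have "(D - {x}) \<union> (- {x} - D) = - {x}" by auto
  moreover have "0 \<le> q x a (- {x} - D)" using assms by (intro q_nonneg) auto
  ultimately show ?thesis using q_compl[OF assms(1), of "{x}"] by simp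
qed

lemma qrate_upper: "a \<in> A x \<Longrightarrow> - q x a {x} \<le> qrate A q x"
  using model unfolding qrate_def ctmdp_model_def by (intro cSUP_upper) auto

text \<open>The model constrains the rates on admissible pairs only, and measurability on the whole
  product needs total functions. The averages \<open>Qpi\<close> integrate over \<open>A x\<close>,
  so they do not change.\<close>

definition q0 :: "'s \<Rightarrow> 'a \<Rightarrow> 's set \<Rightarrow> real" where
  "q0 x a D = (if a \<in> A x then q x a D else 0)"

lemma restrict_K:
  fixes f :: "'s \<Rightarrow> 'a \<Rightarrow> real"
  assumes "(\<lambda>(x, a). f x a) \<in> borel_measurable (restrict_space borel (Kset A))"
  shows "(\<lambda>(x, a). if a \<in> A x then f x a else 0) \<in> borel_measurable (borel \<Otimes>\<^sub>M borel)"
proof -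
  have "(\<lambda>z. indicator (Kset A) z *\<^sub>R (\<lambda>(x, a). f x a) z) \<in> borel_measurable borel"
    using assms K_meas[unfolded borel_prod] by (subst (asm) borel_measurable_restrict_space_iff) simp_all
  also have "(\<lambda>z. indicator (Kset A) z *\<^sub>R (\<lambda>(x, a). f x a) z) = (\<lambda>(x, a). if a \<in> A x then f x a else 0)"
    by (auto simp: fun_eq_iff Kset_def)
  finally show ?thesis unfolding borel_prod .
qed

lemma q0_meas: "D \<in> sets borel \<Longrightarrow> (\<lambda>(x, a). q0 x a D) \<in> borel_measurable (borel \<Otimes>\<^sub>M borel)"
  unfolding q0_def using model by (intro restrict_K) (simp add: ctmdp_model_def)

text \<open>The case where \<^term>\<open>C\<close> is the diagonal makes \<^term>\<open>q x a {x}\<close> jointly measurable,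
  which the model postulates only for a fixed set in place of \<^term>\<open>{x}\<close>.\<close>
lemma q0_section_meas:
  assumes "C \<in> sets (borel \<Otimes>\<^sub>M borel :: ('s \<times> 's) measure)"
  shows "(\<lambda>(x, a). q0 x a (Pair x -` C)) \<in> borel_measurable (borel \<Otimes>\<^sub>M borel)"
proof -
  have sec: "Pair x -` E \<in> sets borel" if "E \<in> sets (borel \<Otimes>\<^sub>M borel :: ('s \<times> 's) measure)" for x and E :: "('s \<times> 's) set"
    using sets_Pair1[OF that] by simp
  show ?thesis
    using Int_stable_pair_measure_generator pair_measure_closed assms
    unfolding sets_pair_measure
  proof (induct rule: sigma_sets_induct_disjoint)
    case (basic E)
    then obtain a b where [measurable]: "a \<in> sets borel" and b: "b \<in> sets borel" and E: "E = a \<times> b" by auto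
    note q0_meas[OF b, measurable]
    have "q0 x \<alpha> (Pair x -` E) = indicator a x * q0 x \<alpha> b" for x \<alpha>
      using signed_measure_on_empty[OF signed] by (auto simp: E q0_def split: split_indicator)
    then show ?case by simp
  next
    case empty
    show ?case using signed_measure_on_empty[OF signed] by (simp add: q0_def if_distrib cong: if_cong)
  next
    case (compl E)
    then have E: "E \<in> sets (borel \<Otimes>\<^sub>M borel :: ('s \<times> 's) measure)" by (simp add: sets_pair_measure)
    have *: "Pair x -` (space borel \<times> space borel - E) = - (Pair x -` E)" for x by auto
    \<comment> \<open>Total mass 0 makes passing to the complement a change of sign.\<close>
    have "q0 x a (Pair x -` (space borel \<times> space borel - E)) = - q0 x a (Pair x -` E)" for x a
      using q_compl[OF _ sec[OF E], of a x x] unfolding * by (simp add: q0_def)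
    moreover have "(\<lambda>z. - q0 (fst z) (snd z) (Pair (fst z) -` E)) \<in> borel_measurable (borel \<Otimes>\<^sub>M borel)"
      using compl(2) by (intro borel_measurable_uminus) (simp only: case_prod_beta')
    ultimately show ?case by (simp only: case_prod_beta')
  next
    case (union E)
    then have E: "E i \<in> sets (borel \<Otimes>\<^sub>M borel :: ('s \<times> 's) measure)" for i by (auto simp: sets_pair_measure)
    have "(\<lambda>i. q0 x a (Pair x -` E i)) sums q0 x a (Pair x -` (\<Union>i. E i))" for x a
    proof (cases "a \<in> A x")
      case True
      have "disjoint_family (\<lambda>i. Pair x -` E i)" using union by (auto simp: disjoint_family_on_def)
      then show ?thesis
        using signed[OF True, unfolded signed_measure_on_def, rule_format, of "\<lambda>i. Pair x -` E i"] sec[OF E]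
        by (simp only: q0_def True if_True vimage_UN) blast
    qed (simp add: q0_def)
    then have eq: "q0 x a (Pair x -` (\<Union>i. E i)) = (\<Sum>i. q0 x a (Pair x -` E i))" for x a by (simp add: sums_unique)
    have [measurable]: "(\<lambda>z. q0 (fst z) (snd z) (Pair (fst z) -` E i)) \<in> borel_measurable (borel \<Otimes>\<^sub>M borel)" for i
      using union(3)[of i] by (simp only: case_prod_beta')
    have "(\<lambda>z. \<Sum>i. q0 (fst z) (snd z) (Pair (fst z) -` E i)) \<in> borel_measurable (borel \<Otimes>\<^sub>M borel)"
      by measurable
    then show ?case by (simp only: eq case_prod_beta')
  qed
qed

text \<open>The section at x of UNIV \<times> D minus the diagonal is D - {x}, and the diagonal is
  closed.\<close>

lemma q0_off_diag_meas:
  assumes D: "D \<in> sets borel"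
  shows "(\<lambda>(x, a). q0 x a (D - {x})) \<in> borel_measurable (borel \<Otimes>\<^sub>M borel)"
proof -
  have "closed {z :: 's \<times> 's. fst z = snd z}"
    by (intro closed_Collect_eq continuous_intros)
  then have "{z :: 's \<times> 's. fst z = snd z} \<in> sets (borel \<Otimes>\<^sub>M borel)"
    unfolding borel_prod by (rule borel_closed)
  moreover have "UNIV \<times> D \<in> sets (borel \<Otimes>\<^sub>M borel :: ('s \<times> 's) measure)" using D by simp
  ultimately have "UNIV \<times> D - {z. fst z = snd z} \<in> sets (borel \<Otimes>\<^sub>M borel :: ('s \<times> 's) measure)"
    by (rule sets.Diff[rotated])
  from q0_section_meas[OF this] show ?thesis
    by (rule back_subst[of "\<lambda>f. f \<in> borel_measurable _"]) (auto simp: fun_eq_iff intro!: arg_cong[of _ _ "q0 _ _"])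
qed

section \<open>Policies as kernels in time and state, and the averaged jump rates\<close>

lemma pi_prob: "0 \<le> t \<Longrightarrow> prob_space (\<pi> t x)"
  and sets_pi: "0 \<le> t \<Longrightarrow> sets (\<pi> t x) = sets borel"
  and pi_A: "0 \<le> t \<Longrightarrow> emeasure (\<pi> t x) (A x) = 1"
  using pol by (simp_all add: admissible_policies_def markov_policy_def)

lemma pi_AE: "0 \<le> t \<Longrightarrow> AE a in \<pi> t x. a \<in> A x"
  using prob_space.AE_in_set_eq_1[OF pi_prob, of t "A x" x] pi_A[of t x] A_meas[of x] sets_pi[of t x]
  by (simp add: measure_def)

lemma pi_cont:
  fixes h :: "'a \<Rightarrow> real"
  assumes h: "h \<in> borel_measurable borel" and bd: "\<And>a. \<bar>h a\<bar> \<le> B"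
  shows "continuous_on UNIV (\<lambda>t. \<integral>a. h a \<partial>\<pi> (max 0 t) x)"
proof -
  have "bounded (range h)" using bd by (auto simp: bounded_iff)
  then have "continuous_on {0..} (\<lambda>t. \<integral>a. h a \<partial>\<pi> t x)"
    using pol h by (simp add: admissible_policies_def)
  moreover have "continuous_on UNIV (\<lambda>t::real. max 0 t)" by (intro continuous_intros)
  ultimately show ?thesis by (rule continuous_on_compose2) auto
qed

text \<open>A policy is measurable in x for fixed t, and admissibility with an indicator as test
  function makes it continuous in t; \<open>caratheodory_measurable\<close> combines the
  two.\<close>

lemma pi_kernel: "(\<lambda>(t, x). \<pi> (max 0 t) x) \<in> measurable (borel \<Otimes>\<^sub>M borel) (subprob_algebra borel)"
proof (rule measurable_subprob_algebra)
  fix z :: "real \<times> 's"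
  show "subprob_space (case z of (t, x) \<Rightarrow> \<pi> (max 0 t) x)"
    using pi_prob[of "max 0 (fst z)"] by (cases z) (simp add: prob_space_imp_subprob_space)
  show "sets (case z of (t, x) \<Rightarrow> \<pi> (max 0 t) x) = sets borel"
    by (cases z) (simp add: sets_pi)
next
  fix B :: "'a set" assume B: "B \<in> sets borel"
  have "(\<lambda>(t, x). measure (\<pi> (max 0 t) x) B) \<in> borel_measurable (borel \<Otimes>\<^sub>M borel)"
  proof (rule caratheodory_measurable)
    show "(\<lambda>x. measure (\<pi> (max 0 t) x) B) \<in> borel_measurable borel" for t
      using pol B by (simp add: admissible_policies_def markov_policy_def)
    have "(\<integral>a. indicator B a \<partial>\<pi> (max 0 t) x) = measure (\<pi> (max 0 t) x) B" for t x
      using B sets_pi[of "max 0 t" x] by simp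
    then show "continuous_on UNIV (\<lambda>t. measure (\<pi> (max 0 t) x) B)" for x
      using pi_cont[of "indicat_real B" 1 x] B by (simp split: split_indicator)
  qed
  then have "(\<lambda>z. ennreal ((\<lambda>(t, x). measure (\<pi> (max 0 t) x) B) z)) \<in> borel_measurable (borel \<Otimes>\<^sub>M borel)"
    by measurable
  then show "(\<lambda>z. emeasure (case z of (t, x) \<Rightarrow> \<pi> (max 0 t) x) B) \<in> borel_measurable (borel \<Otimes>\<^sub>M borel)"
    using pi_prob by (simp add: case_prod_beta' finite_measure.emeasure_eq_measure prob_space.finite_measure)
qed

lemma nn_integral_pi_meas:
  fixes G :: "'s \<Rightarrow> 'a \<Rightarrow> ennreal"
  assumes G: "(\<lambda>(x, a). G x a) \<in> borel_measurable (borel \<Otimes>\<^sub>M borel)"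
  shows "(\<lambda>(t, x). \<integral>\<^sup>+a. G x a \<partial>\<pi> (max 0 t) x) \<in> borel_measurable (borel \<Otimes>\<^sub>M borel)"
proof -
  have "(\<lambda>(z :: real \<times> 's, a). G (snd z) a) \<in> borel_measurable ((borel \<Otimes>\<^sub>M borel) \<Otimes>\<^sub>M borel)"
  proof -
    have "(\<lambda>w. (snd (fst w), snd w)) \<in> measurable (((borel :: real measure) \<Otimes>\<^sub>M borel) \<Otimes>\<^sub>M borel) (borel \<Otimes>\<^sub>M borel)"
      by measurable
    from measurable_compose[OF this G] show ?thesis by (simp add: case_prod_beta')
  qed
  from nn_integral_measurable_subprob_algebra2[OF this pi_kernel]
  show ?thesis by (simp add: case_prod_beta')
qed

lemma section_meas:
  assumes "(\<lambda>(x, a). G x a) \<in> borel_measurable (borel \<Otimes>\<^sub>M borel)"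
  shows "G x \<in> borel_measurable borel"
  using measurable_compose_Pair1[OF _ assms, of x] by simp

definition jumpK :: "'s \<Rightarrow> 'a \<Rightarrow> 's measure" where
  "jumpK x a = (if a \<in> A x then jump_meas x (q x a) else null_measure borel)"

lemma emeasure_jump_meas:
  assumes a: "a \<in> A x" and D: "D \<in> sets borel"
  shows "emeasure (jump_meas x (q x a)) D = ennreal (q x a (D - {x}))"
  unfolding jump_meas_def
proof (rule emeasure_measure_of_sigma)
  show "sigma_algebra UNIV (sets borel)" using sets.sigma_algebra_axioms[of borel] by simp
  show "positive (sets borel) (\<lambda>D. ennreal (q x a (D - {x})))"
    using signed_measure_on_empty[OF signed[OF a]] by (simp add: positive_def)
  show "countably_additive (sets borel) (\<lambda>D. ennreal (q x a (D - {x})))"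
  proof (rule countably_additiveI)
    fix B :: "nat \<Rightarrow> 's set" assume B: "range B \<subseteq> sets borel" "disjoint_family B"
    have Bi: "B i - {x} \<in> sets borel" for i using B by auto
    have "disjoint_family (\<lambda>i. B i - {x})" using B(2) by (auto simp: disjoint_family_on_def)
    then have "(\<lambda>i. q x a (B i - {x})) sums q x a (\<Union>i. B i - {x})"
      using signed[OF a, unfolded signed_measure_on_def, rule_format, of "\<lambda>i. B i - {x}"] Bi by blast
    moreover have "(\<Union>i. B i - {x}) = \<Union> (range B) - {x}" by auto
    moreover have "\<Union> (range B) - {x} \<in> sets borel" using B by auto
    ultimately have "(\<lambda>i. ennreal (q x a (B i - {x}))) sums ennreal (q x a (\<Union> (range B) - {x}))"
      using q_nonneg[OF a Bi] q_nonneg[OF a, of "\<Union> (range B) - {x}"] by (subst sums_ennreal) auto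
    then show "(\<Sum>i. ennreal (q x a (B i - {x}))) = ennreal (q x a (\<Union> (range B) - {x}))"
      by (rule sums_unique[symmetric])
  qed
qed (fact D)

lemma emeasure_jumpK:
  assumes "D \<in> sets borel"
  shows "emeasure (jumpK x a) D = ennreal (q0 x a (D - {x}))"
  using assms by (simp add: jumpK_def q0_def emeasure_jump_meas)

lemma sets_jumpK [simp]: "sets (jumpK x a) = sets borel"
  by (simp add: jumpK_def)

lemma nn_integral_jumpK_meas:
  assumes [measurable]: "\<phi> \<in> borel_measurable borel"
  shows "(\<lambda>(x, a). \<integral>\<^sup>+y. \<phi> y \<partial>jumpK x a) \<in> borel_measurable (borel \<Otimes>\<^sub>M borel)"
proof -
  have "(\<lambda>z. \<integral>\<^sup>+y. \<phi> y \<partial>jumpK (fst z) (snd z)) \<in> borel_measurable (borel \<Otimes>\<^sub>M borel)"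
  proof (rule nn_integral_measurable_finite_kernel[where N = borel])
    fix D :: "'s set" assume D: "D \<in> sets borel"
    note q0_off_diag_meas[OF D]
    then have [measurable]: "(\<lambda>z. q0 (fst z) (snd z) (D - {fst z})) \<in> borel_measurable (borel \<Otimes>\<^sub>M borel)"
      by (simp only: case_prod_beta')
    show "(\<lambda>z. emeasure (jumpK (fst z) (snd z)) D) \<in> borel_measurable (borel \<Otimes>\<^sub>M borel)"
      unfolding emeasure_jumpK[OF D] by measurable
  next
    show "emeasure (jumpK (fst z) (snd z)) (space borel) < \<infinity>" for z
      by (simp add: emeasure_jumpK)
  qed auto
  then show ?thesis by (simp only: case_prod_beta')
qed

text \<open>Policies are constrained only at nonnegative times; replacing \<^term>\<open>t\<close> by \<^term>\<open>max 0 t\<close>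
  makes the rates measurable and continuous on the whole time axis.\<close>
definition lam :: "real \<Rightarrow> 's \<Rightarrow> real" where
  "lam t x = - Qpi A q \<pi> (max 0 t) x {x}"

definition J :: "real \<Rightarrow> 's \<Rightarrow> 's measure" where
  "J t x = jump_meas x (Qpi A q \<pi> (max 0 t) x)"

lemma sets_J: "sets (J t x) = sets borel" by (simp add: J_def)

text \<open>With \<open>max 0\<close> the bound also covers inadmissible a, where \<open>q0\<close>
  is 0, without an argument about the sign of the supremum \<open>qrate\<close>.\<close>

lemma q0_bounds:
  assumes "D \<in> sets borel"
  shows "0 \<le> q0 x a (D - {x})" "q0 x a (D - {x}) \<le> max 0 (qrate A q x)"
  using q_nonneg[of a x "D - {x}"] q_diff_le[OF _ assms, of a x] qrate_upper[of a x] assms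
  by (auto simp: q0_def)

lemma q0_singleton: "q0 x a {x} \<le> 0" "\<bar>- q0 x a {x}\<bar> \<le> max 0 (qrate A q x)"
  using qrate_upper[of a x] q_nonneg[of a x "- {x}"] q_compl[of a x "{x}"]
  by (auto simp: q0_def)

lemma q0_singleton_section: "(\<lambda>a. q0 x a {x}) \<in> borel_measurable borel"
  using section_meas[OF q0_meas[of "{x}"], of x] by simp

lemma q0_diff_section: "D \<in> sets borel \<Longrightarrow> (\<lambda>a. q0 x a (D - {x})) \<in> borel_measurable borel"
  by (rule section_meas[OF q0_off_diag_meas])

lemma Qpi_q0: "Qpi A q \<pi> t x D = (\<integral>a. q0 x a D \<partial>\<pi> t x)"
  unfolding Qpi_def set_lebesgue_integral_def
  by (intro Bochner_Integration.integral_cong) (auto simp: q0_def)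

lemma pi_integrable:
  fixes h :: "'a \<Rightarrow> real"
  assumes t: "0 \<le> t" and h: "h \<in> borel_measurable borel" and bd: "\<And>a. \<bar>h a\<bar> \<le> B"
  shows "integrable (\<pi> t x) h"
proof -
  interpret prob_space "\<pi> t x" by (rule pi_prob[OF t])
  show ?thesis
    using h bd by (intro integrable_const_bound[of _ B]) (auto simp: measurable_cong_sets[OF sets_pi[OF t] refl])
qed

lemma q0_diff_integral:
  assumes t: "0 \<le> t" and D: "D \<in> sets borel"
  shows "ennreal (Qpi A q \<pi> t x (D - {x})) = (\<integral>\<^sup>+a. emeasure (jumpK x a) D \<partial>\<pi> t x)"
  unfolding Qpi_q0 emeasure_jumpK[OF D] using q0_bounds[OF D, of x] q0_diff_section[OF D]
  by (intro nn_integral_eq_integral[symmetric] pi_integrable[OF t, where B = "max 0 (qrate A q x)"]) auto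

text \<open>\<open>J\<close> is given only through its averaged set function. The averaged integral
  is additive, homogeneous and continuous along increasing sequences, so
  \<open>nn_integral_measure_of_functional\<close> delivers countable additivity together with this
  exchange of integrals.\<close>

lemma nn_integral_J:
  assumes \<phi>: "\<phi> \<in> borel_measurable borel"
  shows "(\<integral>\<^sup>+y. \<phi> y \<partial>J t x) = (\<integral>\<^sup>+a. (\<integral>\<^sup>+y. \<phi> y \<partial>jumpK x a) \<partial>\<pi> (max 0 t) x)"
proof -
  let ?\<Phi> = "\<lambda>\<phi>. \<integral>\<^sup>+a. (\<integral>\<^sup>+y. \<phi> y \<partial>jumpK x a) \<partial>\<pi> (max 0 t) x"
  have meas: "(\<lambda>a. \<integral>\<^sup>+y. \<phi> y \<partial>jumpK x a) \<in> borel_measurable (\<pi> (max 0 t) x)"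
    if "\<phi> \<in> borel_measurable borel" for \<phi>
    using section_meas[OF nn_integral_jumpK_meas[OF that], of x]
    by (simp add: measurable_cong_sets[OF sets_pi refl])
  have meas': "\<phi> \<in> borel_measurable (jumpK x a)" if "\<phi> \<in> borel_measurable borel" for \<phi> :: "'s \<Rightarrow> ennreal" and a
    using that by (simp add: measurable_cong_sets[OF sets_jumpK refl])
  have "J t x = measure_of (space borel) (sets borel) (\<lambda>D. ?\<Phi> (indicator D))"
    unfolding J_def jump_meas_def space_borel
  proof (rule measure_of_eq)
    fix D :: "'s set" assume "D \<in> sigma_sets UNIV (sets borel)"
    then have D: "D \<in> sets borel" using sets.sigma_sets_eq[of "borel :: 's measure"] by simp
    then show "ennreal (Qpi A q \<pi> (max 0 t) x (D - {x})) = ?\<Phi> (indicator D)"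
      by (simp add: q0_diff_integral)
  qed simp
  also have "(\<integral>\<^sup>+y. \<phi> y \<partial>\<dots>) = ?\<Phi> \<phi>"
  proof (rule nn_integral_measure_of_functional[OF _ _ _ _ \<phi>])
    fix f g :: "'s \<Rightarrow> ennreal" assume fg: "f \<in> borel_measurable borel" "g \<in> borel_measurable borel"
    show "?\<Phi> (\<lambda>x. f x + g x) = ?\<Phi> f + ?\<Phi> g"
      using fg by (simp add: nn_integral_add meas meas')
  next
    fix f :: "'s \<Rightarrow> ennreal" and k assume f: "f \<in> borel_measurable borel"
    show "?\<Phi> (\<lambda>x. k * f x) = k * ?\<Phi> f"
      using f by (simp add: nn_integral_cmult meas meas')
  next
    fix F :: "nat \<Rightarrow> 's \<Rightarrow> ennreal" assume F: "\<And>i. F i \<in> borel_measurable borel" "incseq F"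
    have "?\<Phi> (\<lambda>x. SUP i. F i x) = (\<integral>\<^sup>+a. (SUP i. \<integral>\<^sup>+y. F i y \<partial>jumpK x a) \<partial>\<pi> (max 0 t) x)"
      using F by (simp add: nn_integral_monotone_convergence_SUP meas')
    also have "\<dots> = (SUP i. ?\<Phi> (F i))"
      using F by (intro nn_integral_monotone_convergence_SUP meas)
        (auto simp: incseq_def le_fun_def intro!: nn_integral_mono)
    finally show "?\<Phi> (\<lambda>x. SUP i. F i x) = (SUP i. ?\<Phi> (F i))" .
  qed (metis space_borel UNIV_I ext)
  finally show ?thesis .
qed

lemma emeasure_J:
  assumes "D \<in> sets borel"
  shows "emeasure (J t x) D = (\<integral>\<^sup>+a. ennreal (q0 x a (D - {x})) \<partial>\<pi> (max 0 t) x)"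
  using nn_integral_J[of "indicator D" t x] assms by (simp add: sets_J emeasure_jumpK)

lemma lam_eq: "lam t x = (\<integral>a. - q0 x a {x} \<partial>\<pi> (max 0 t) x)"
  by (simp add: lam_def Qpi_q0)

lemma lam_integrable: "integrable (\<pi> (max 0 t) x) (\<lambda>a. - q0 x a {x})"
  using q0_singleton_section[of x] q0_singleton(2)[of x]
  by (intro pi_integrable[where B = "max 0 (qrate A q x)"]) simp_all

lemma lam_nonneg: "0 \<le> lam t x"
  unfolding lam_eq using q0_singleton(1) by (intro Bochner_Integration.integral_nonneg) auto

lemma emeasure_J_UNIV: "emeasure (J t x) UNIV = ennreal (lam t x)"
proof -
  have "q0 x a (UNIV - {x}) = - q0 x a {x}" for a
    using q_compl[of a x "{x}"] by (simp add: q0_def Compl_eq_Diff_UNIV)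
  then have "emeasure (J t x) UNIV = (\<integral>\<^sup>+a. ennreal (- q0 x a {x}) \<partial>\<pi> (max 0 t) x)"
    by (simp add: emeasure_J)
  also have "\<dots> = ennreal (lam t x)"
    unfolding lam_eq using q0_singleton(1) by (intro nn_integral_eq_integral lam_integrable) auto
  finally show ?thesis .
qed

sublocale jump_rates lam J
proof
  show "0 \<le> lam t x" for t x by (rule lam_nonneg)
  show J_meas: "(\<lambda>(t, x). emeasure (J t x) D) \<in> borel_measurable (borel \<Otimes>\<^sub>M borel)" if D: "D \<in> sets borel" for D
  proof -
    from q0_off_diag_meas[OF D]
    have "(\<lambda>(x, a). ennreal (q0 x a (D - {x}))) \<in> borel_measurable (borel \<Otimes>\<^sub>M borel)"
      by (simp add: case_prod_beta')
    from nn_integral_pi_meas[OF this] show ?thesis by (simp add: emeasure_J[OF D])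
  qed
  \<comment> \<open>As the total mass of \<open>J\<close>, the exit rate inherits the joint
    measurability just shown.\<close>
  have "lam t x = enn2real (emeasure (J t x) UNIV)" for t x
    using lam_nonneg by (simp add: emeasure_J_UNIV)
  then have "(\<lambda>(t, x). lam t x) = (\<lambda>z. enn2real ((\<lambda>(t, x). emeasure (J t x) UNIV) z))"
    by (simp add: fun_eq_iff)
  also have "\<dots> \<in> borel_measurable (borel \<Otimes>\<^sub>M borel)" using J_meas[of UNIV] by simp
  finally show "(\<lambda>(t, x). lam t x) \<in> borel_measurable (borel \<Otimes>\<^sub>M borel)" .
  show "continuous_on UNIV (\<lambda>t. lam t x)" for x
    unfolding lam_eq using q0_singleton_section[of x] q0_singleton(2)[of x]
    by (intro pi_cont[where B = "max 0 (qrate A q x)"]) simp_all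
  show "sets (J t x) = sets borel" for t x by (rule sets_J)
  show "emeasure (J t x) UNIV = ennreal (lam t x)" for t x by (rule emeasure_J_UNIV)
qed

text \<open>For each admissible action, moving the point mass at x to the right bounds the jump
  integral by \<open>h a\<close>, whose mean under the policy is the claimed right-hand side. The
  jump integral is nonnegative, hence so are \<open>h\<close> almost everywhere and its
  mean.\<close>

lemma J_drift:
  fixes W :: "'s \<Rightarrow> real"
  assumes W: "W \<in> borel_measurable borel" and W0: "\<And>y. 0 \<le> W y"
    and drift: "\<And>x a. a \<in> A x \<Longrightarrow> rate_integrable x (q x a) W \<and> rate_int x (q x a) W \<le> k * W x + b"
  shows "(\<integral>\<^sup>+y. ennreal (W y) \<partial>J t x) \<le> ennreal ((lam t x + k) * W x + b)"
    and "0 \<le> (lam t x + k) * W x + b"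
proof -
  define h where "h a = - q0 x a {x} * W x + (k * W x + b)" for a
  let ?\<pi> = "\<pi> (max 0 t) x"
  interpret prob_space ?\<pi> by (rule pi_prob) simp
  have h_int: "integrable ?\<pi> h"
    unfolding h_def by (rule Bochner_Integration.integrable_add[OF integrable_mult_left[OF lam_integrable] integrable_const])
  have "integral\<^sup>L ?\<pi> h = lam t x * W x + (k * W x + b)"
    unfolding h_def lam_eq
    by (subst Bochner_Integration.integral_add[OF integrable_mult_left[OF lam_integrable] integrable_const]) (simp add: prob_space)
  then have int_h: "integral\<^sup>L ?\<pi> h = (lam t x + k) * W x + b" by (simp add: algebra_simps)
  have pw: "(\<integral>\<^sup>+y. ennreal (W y) \<partial>jumpK x a) \<le> ennreal (h a) \<and> 0 \<le> h a" if a: "a \<in> A x" for a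
  proof -
    let ?i = "\<integral>y. W y \<partial>jump_meas x (q x a)"
    have "(\<integral>\<^sup>+y. ennreal (W y) \<partial>jumpK x a) = ennreal ?i"
      using a W0 drift[OF a] by (simp add: jumpK_def rate_integrable_def nn_integral_eq_integral)
    moreover have "?i \<le> h a"
      using drift[OF a] a by (simp add: rate_int_def h_def q0_def mult.commute)
    moreover have "0 \<le> ?i" using W0 by (intro Bochner_Integration.integral_nonneg) auto
    ultimately show ?thesis by (simp add: ennreal_leI)
  qed
  have AE: "AE a in ?\<pi>. a \<in> A x" by (rule pi_AE) simp
  have h0: "AE a in ?\<pi>. 0 \<le> h a" using AE by eventually_elim (simp add: pw)
  show "0 \<le> (lam t x + k) * W x + b" unfolding int_h[symmetric] by (rule integral_nonneg_AE[OF h0])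
  have "(\<integral>\<^sup>+y. ennreal (W y) \<partial>J t x) = (\<integral>\<^sup>+a. (\<integral>\<^sup>+y. ennreal (W y) \<partial>jumpK x a) \<partial>?\<pi>)"
    using W by (intro nn_integral_J) simp
  also have "\<dots> \<le> (\<integral>\<^sup>+a. ennreal (h a) \<partial>?\<pi>)"
    by (intro nn_integral_mono_AE, use AE in eventually_elim) (simp add: pw)
  also have "\<dots> = ennreal (integral\<^sup>L ?\<pi> h)" by (rule nn_integral_eq_integral[OF h_int h0])
  finally show "(\<integral>\<^sup>+y. ennreal (W y) \<partial>J t x) \<le> ennreal ((lam t x + k) * W x + b)" by (simp only: int_h)
qed

lemma lam_le_qrate: "lam t x \<le> qrate A q x"
proof -
  interpret prob_space "\<pi> (max 0 t) x" by (rule pi_prob) simp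
  have "AE a in \<pi> (max 0 t) x. a \<in> A x" by (rule pi_AE) simp
  then have "AE a in \<pi> (max 0 t) x. - q0 x a {x} \<le> qrate A q x"
    by eventually_elim (simp add: q0_def qrate_upper)
  then have "(\<integral>a. - q0 x a {x} \<partial>\<pi> (max 0 t) x) \<le> (\<integral>a. qrate A q x \<partial>\<pi> (max 0 t) x)"
    by (intro integral_mono_AE lam_integrable) simp_all
  then show ?thesis by (simp add: lam_eq prob_space)
qed

lemma
  assumes bd: "\<And>x a. a \<in> A x \<Longrightarrow> \<bar>r x a\<bar> \<le> B x"
  shows rpi_abs_le: "\<bar>rpi A r \<pi> (max 0 t) x\<bar> \<le> B x"
    and rpi_measurable: "(\<lambda>(t, x). rpi A r \<pi> (max 0 t) x) \<in> borel_measurable (borel \<Otimes>\<^sub>M borel)"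
proof -
  define r0 where "r0 x a = (if a \<in> A x then r x a else 0)" for x a
  have r0_meas: "(\<lambda>(x, a). r0 x a) \<in> borel_measurable (borel \<Otimes>\<^sub>M borel)"
    unfolding r0_def using model by (intro restrict_K) (simp add: ctmdp_model_def)
  have rpi: "rpi A r \<pi> t x = (\<integral>a. r0 x a \<partial>\<pi> t x)" for t x
    unfolding rpi_def set_lebesgue_integral_def
    by (intro Bochner_Integration.integral_cong) (auto simp: r0_def)
  have int: "integrable (\<pi> (max 0 t) x) (r0 x)" for t x
    using bd by (intro pi_integrable[where B = "max 0 (B x)"] section_meas[OF r0_meas])
      (auto simp: r0_def le_max_iff_disj)
  show "\<bar>rpi A r \<pi> (max 0 t) x\<bar> \<le> B x"
  proof -
    interpret prob_space "\<pi> (max 0 t) x" by (rule pi_prob) simp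
    have "AE a in \<pi> (max 0 t) x. a \<in> A x" by (rule pi_AE) simp
    then have "AE a in \<pi> (max 0 t) x. \<bar>r0 x a\<bar> \<le> B x"
      by eventually_elim (simp add: r0_def bd)
    then have "(\<integral>a. \<bar>r0 x a\<bar> \<partial>\<pi> (max 0 t) x) \<le> (\<integral>a. B x \<partial>\<pi> (max 0 t) x)"
      by (intro integral_mono_AE integrable_abs int) simp_all
    also have "(\<integral>a. B x \<partial>\<pi> (max 0 t) x) = B x" by (simp add: prob_space)
    finally show ?thesis
      unfolding rpi by (rule order_trans[OF integral_abs_bound])
  qed
  have "(\<lambda>(x, a). ennreal (r0 x a)) \<in> borel_measurable (borel \<Otimes>\<^sub>M borel)"
    "(\<lambda>(x, a). ennreal (- r0 x a)) \<in> borel_measurable (borel \<Otimes>\<^sub>M borel)"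
    using r0_meas by (simp_all add: case_prod_beta')
  note [measurable] = this[THEN nn_integral_pi_meas]
  have "(\<lambda>(t, x). rpi A r \<pi> (max 0 t) x) = (\<lambda>z. enn2real ((\<lambda>(t, x). \<integral>\<^sup>+a. ennreal (r0 x a) \<partial>\<pi> (max 0 t) x) z)
      - enn2real ((\<lambda>(t, x). \<integral>\<^sup>+a. ennreal (- r0 x a) \<partial>\<pi> (max 0 t) x) z))"
    using int by (auto simp: fun_eq_iff rpi real_lebesgue_integral_def)
  also have "\<dots> \<in> borel_measurable (borel \<Otimes>\<^sub>M borel)" by measurable
  finally show "(\<lambda>(t, x). rpi A r \<pi> (max 0 t) x) \<in> borel_measurable (borel \<Otimes>\<^sub>M borel)" .
qed

section \<open>Identification with the minimal transition function\<close>

lemma surv_Qpi: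
  assumes "0 \<le> s"
  shows "exp (- (LINT v:{s..u}|lborel. - Qpi A q \<pi> v x {x})) = surv s u x"
proof -
  have "(LINT v:{s..u}|lborel. - Qpi A q \<pi> v x {x}) = (LINT v:{s..u}|lborel. lam v x)"
    unfolding set_lebesgue_integral_def using assms
    by (intro Bochner_Integration.integral_cong) (auto simp: lam_def max_absorb2 split: split_indicator)
  then show ?thesis by (simp add: surv_def)
qed

text \<open>Started at s \<ge> 0 the recursion visits only times u \<ge> s, where replacing u by
  \<open>max 0 u\<close> changes nothing.\<close>

lemma pmin_iter_eq:
  "0 \<le> s \<Longrightarrow> pmin_iter n (Qpi A q \<pi>) s x t D = (step t ^^ n) (no_jump t (indicator D)) s x"
proof (induction n arbitrary: s x)
  case 0
  then show ?case by (simp add: surv_Qpi no_jump_def)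
next
  case (Suc n)
  show ?case
    unfolding pmin_iter.simps funpow.simps o_apply step_def[of t "(step t ^^ n) _"] surv_Qpi[OF Suc.prems]
  proof (intro nn_integral_cong)
    fix u
    show "indicator {s..t} u * ennreal (surv s u x) * (\<integral>\<^sup>+y. pmin_iter n (Qpi A q \<pi>) u y t D \<partial>jump_meas x (Qpi A q \<pi> u x))
      = indicator {s..t} u * ennreal (surv s u x) * (\<integral>\<^sup>+y. (step t ^^ n) (no_jump t (indicator D)) u y \<partial>J u x)"
    proof (cases "u \<in> {s..t}")
      case True
      then have "0 \<le> u" using Suc.prems by simp
      then show ?thesis by (simp add: Suc.IH J_def[of u] max_absorb2)
    qed simp
  qed
qed

text \<open>Linearity and monotone continuity of \<open>trans_op\<close> also show that
  \<open>pmin\<close> is countably additive in the target set; if it were not,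
  \<open>measure_of\<close> would fall back to the zero measure.\<close>

lemma nn_integral_trans_meas:
  assumes "\<phi> \<in> borel_measurable borel"
  shows "(\<integral>\<^sup>+y. \<phi> y \<partial>trans_meas (Qpi A q \<pi>) 0 x t) = trans_op t \<phi> 0 x"
proof -
  have "trans_meas (Qpi A q \<pi>) 0 x t = measure_of (space borel) (sets borel) (\<lambda>D. trans_op t (indicator D) 0 x)"
    unfolding trans_meas_def by (simp add: pmin_def[abs_def] pmin_iter_eq trans_op_def pot_def)
  moreover have "(\<integral>\<^sup>+y. \<phi> y \<partial>measure_of (space borel) (sets borel) (\<lambda>D. trans_op t (indicator D) 0 x)) = trans_op t \<phi> 0 x"
    by (rule nn_integral_measure_of_functional[of borel "\<lambda>\<phi>. trans_op t \<phi> 0 x", OF trans_op_add trans_op_cmult trans_op_SUP _ assms])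
      (simp_all, metis ext)
  ultimately show ?thesis by simp
qed

lemma sets_trans_meas: "sets (trans_meas (Qpi A q \<pi>) s x t) = sets borel"
proof -
  have "sigma_sets UNIV (sets borel) = sets (borel :: 's measure)"
    using sets.sigma_sets_eq[of "borel :: 's measure"] by simp
  then show ?thesis by (simp add: trans_meas_def)
qed

end

subsection \<open>Long-run averages\<close>

locale ctmdp_lyapunov = ctmdp A q r \<pi>
  for A :: "'s::polish_space \<Rightarrow> 'a::polish_space set" and q r \<pi> +
  fixes w w' :: "'s \<Rightarrow> real" and c b Mq M c' b' M' :: real
  assumes assmA: "assumption_A A q w c b Mq"
    and assmB: "assumption_B A q r w M w' c' b' M'"
begin

sublocale lyapunov_rates lam J w w' c b c' b' M'
proof
  show "w \<in> borel_measurable borel" "1 \<le> w y" "0 < c" "0 \<le> b" for y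
    using assmA by (simp_all add: assumption_A_def)
  show "w' \<in> borel_measurable borel" "0 \<le> w' y" "0 < c'" "0 \<le> b'" "0 < M'" for y
    using assmB by (simp_all add: assumption_B_def)
  have w: "rate_integrable x (q x a) w \<and> rate_int x (q x a) w \<le> - c * w x + b" if "a \<in> A x" for x a
    using assmA that by (simp add: assumption_A_def)
  have w0: "0 \<le> w y" for y using \<open>1 \<le> w y\<close> by simp
  show "(\<integral>\<^sup>+z. ennreal (w z) \<partial>J t y) \<le> ennreal ((lam t y - c) * w y + b)" "0 \<le> (lam t y - c) * w y + b" for t y
    using J_drift[of w "- c" b, OF \<open>w \<in> borel_measurable borel\<close> w0 w] by simp_all
  have w': "rate_integrable x (q x a) w' \<and> rate_int x (q x a) w' \<le> c' * w' x + b'" if "a \<in> A x" for x a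
    using assmB that by (simp add: assumption_B_def)
  show "(\<integral>\<^sup>+z. ennreal (w' z) \<partial>J t y) \<le> ennreal ((lam t y + c') * w' y + b')" "0 \<le> (lam t y + c') * w' y + b'" for t y
    by (rule J_drift[of w' c' b', OF \<open>w' \<in> borel_measurable borel\<close> \<open>\<And>y. 0 \<le> w' y\<close> w'], assumption)+
  have "lam t y * w y \<le> qrate A q y * w y" for t y by (intro mult_right_mono lam_le_qrate w0)
  also have "qrate A q y * w y \<le> M' * w' y" for y using assmB by (simp add: assumption_B_def)
  finally show "lam t y * w y \<le> M' * w' y" for t y .
qed

lemma r_bound: "a \<in> A x \<Longrightarrow> \<bar>r x a\<bar> \<le> M * w x" and M: "0 \<le> M"
  using assmB by (simp_all add: assumption_B_def)

definition total_reward :: "'s \<Rightarrow> real \<Rightarrow> real" where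
  "total_reward x T = (LINT t:{0..T}|lborel. exp_reward A q r \<pi> x t)"

text \<open>The factor \<sigma> treats both halves of the theorem at once: \<sigma> = -1 amounts to
  passing to -r, -u and -g. The constant K depends on x and u but not on T.\<close>

lemma total_reward_bound:
  assumes u: "u \<in> Bw w" and \<sigma>: "\<sigma> = 1 \<or> \<sigma> = (-1 :: real)"
    and g: "\<And>x t. 0 \<le> t \<Longrightarrow> \<sigma> * (rpi A r \<pi> t x + rate_int x (Qpi A q \<pi> t x) u) \<le> \<sigma> * g"
  shows "\<exists>K. \<forall>T\<ge>0. \<sigma> * total_reward x T \<le> \<sigma> * g * T + K"
proof -
  from u obtain C' where u_meas [measurable]: "u \<in> borel_measurable borel" and C': "\<And>y. \<bar>u y\<bar> / w y \<le> C'"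
    by (auto simp: Bw_def bdd_above_def)
  define C where "C = max 0 C'"
  have C: "0 \<le> C" "\<bar>u y\<bar> \<le> C * w y" for y
  proof -
    have "\<bar>u y\<bar> / w y \<le> C" using C'[of y] by (simp add: C_def)
    then show "\<bar>u y\<bar> \<le> C * w y" using w_ge_1[of y] by (simp add: pos_divide_le_eq)
  qed (simp add: C_def)
  have "\<sigma> * total_reward x T \<le> \<sigma> * g * T + (\<bar>\<sigma> * u x\<bar> + C * (w x + b / c))" if T: "0 \<le> T" for T
  proof -
    \<comment> \<open>Using \<open>max 0 t\<close> makes \<rho> measurable on the whole time axis;
      on {0..T} it is \<sigma> times the reward rate under \<pi>.\<close>
    define \<rho> where "\<rho> t y = \<sigma> * rpi A r \<pi> (max 0 t) y" for t y
    have "\<sigma> * total_reward x T = (LINT t:{0..T}|lborel. \<sigma> * exp_reward A q r \<pi> x t)"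
      unfolding total_reward_def by simp
    also have "\<dots> = (LINT t:{0..T}|lborel. \<integral>y. \<rho> t y \<partial>trans_meas (Qpi A q \<pi>) 0 x t)"
      unfolding set_lebesgue_integral_def exp_reward_def \<rho>_def
      by (intro Bochner_Integration.integral_cong) (auto simp: max_absorb2 split: split_indicator)
    also have "\<dots> \<le> (\<sigma> * g) * T + (\<bar>\<sigma> * u x\<bar> + C * (w x + b / c))"
    proof (rule integrated_reward_le[OF _ _ M T sets_trans_meas nn_integral_trans_meas _ _ C(1)])
      show "(\<lambda>(t, y). \<rho> t y) \<in> borel_measurable (borel \<Otimes>\<^sub>M borel)"
        unfolding \<rho>_def using rpi_measurable[of "\<lambda>x. M * w x", OF r_bound] by (simp add: case_prod_beta')
      show "\<bar>\<rho> t y\<bar> \<le> M * w y" for t y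
        using rpi_abs_le[of "\<lambda>x. M * w x", OF r_bound] \<sigma> by (auto simp: \<rho>_def)
      show "(\<lambda>y. \<sigma> * u y) \<in> borel_measurable borel" by measurable
      show "\<bar>\<sigma> * u y\<bar> \<le> C * w y" for y using C(2)[of y] \<sigma> by auto
      show "\<rho> t y + (\<integral>z. \<sigma> * u z \<partial>J t y) - lam t y * (\<sigma> * u y) \<le> \<sigma> * g" if t: "0 \<le> t" for t y
        using g[OF t, of y] t
        by (simp add: \<rho>_def rate_int_def J_def lam_def max_absorb2 algebra_simps)
    qed
    finally show ?thesis .
  qed
  then show ?thesis by blast
qed

lemma avg_reward_total: "avg_reward A q r \<pi> x = Liminf at_top (\<lambda>T. ereal (1 / T * total_reward x T))"
  by (simp add: avg_reward_def total_reward_def)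

end

lemma tendsto_affine_average: "((\<lambda>T. g + K / T) \<longlongrightarrow> g) at_top" for g K :: real
proof -
  have "((\<lambda>T::real. g + K / T) \<longlongrightarrow> g + 0) at_top"
    by (intro tendsto_add tendsto_const real_tendsto_divide_at_top[OF tendsto_const] filterlim_ident)
  then show ?thesis by simp
qed

lemma Liminf_average_le:
  fixes R :: "real \<Rightarrow> real"
  assumes "\<And>T. 0 \<le> T \<Longrightarrow> R T \<le> g * T + K"
  shows "Liminf at_top (\<lambda>T. ereal (1 / T * R T)) \<le> ereal g"
proof -
  have "Liminf at_top (\<lambda>T. ereal (1 / T * R T)) \<le> Liminf at_top (\<lambda>T. ereal (g + K / T))"
  proof (intro Liminf_mono eventually_mono[OF eventually_gt_at_top[of 0]])
    fix T :: real assume "0 < T"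
    then show "ereal (1 / T * R T) \<le> ereal (g + K / T)"
      using divide_right_mono[OF assms[of T], of T] by (simp add: add_divide_distrib)
  qed
  also have "\<dots> = ereal g"
    by (intro lim_imp_Liminf tendsto_ereal tendsto_affine_average) simp
  finally show ?thesis .
qed

lemma Liminf_average_ge:
  fixes R :: "real \<Rightarrow> real"
  assumes "\<And>T. 0 \<le> T \<Longrightarrow> g * T + K \<le> R T"
  shows "ereal g \<le> Liminf at_top (\<lambda>T. ereal (1 / T * R T))"
proof -
  have "ereal g = Liminf at_top (\<lambda>T. ereal (g + K / T))"
    by (intro lim_imp_Liminf[symmetric] tendsto_ereal tendsto_affine_average) simp
  also have "\<dots> \<le> Liminf at_top (\<lambda>T. ereal (1 / T * R T))"
  proof (intro Liminf_mono eventually_mono[OF eventually_gt_at_top[of 0]])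
    fix T :: real assume "0 < T"
    then show "ereal (g + K / T) \<le> ereal (1 / T * R T)"
      using divide_right_mono[OF assms[of T], of T] by (simp add: add_divide_distrib)
  qed
  finally show ?thesis .
qed

theorem theorem4p1:
  fixes A :: "'s::polish_space \<Rightarrow> 'a::polish_space set"
    and q :: "'s \<Rightarrow> 'a \<Rightarrow> 's set \<Rightarrow> real"
    and r :: "'s \<Rightarrow> 'a \<Rightarrow> real"
    and w w' :: "'s \<Rightarrow> real"
    and c b Mq M c' b' M' :: real
    and \<pi> :: "real \<Rightarrow> 's \<Rightarrow> 'a measure"
  assumes model: "ctmdp_model A q r"
    and assmA: "assumption_A A q w c b Mq"
    and assmB: "assumption_B A q r w M w' c' b' M'"
    and assmC: "assumption_C A q r w"
    and pol: "\<pi> \<in> admissible_policies A"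
  shows "(\<forall>(g::real) u. u \<in> Bw w \<and>
            (\<forall>x. \<forall>t\<ge>0. g \<ge> rpi A r \<pi> t x + rate_int x (Qpi A q \<pi> t x) u)
          \<longrightarrow> (\<forall>x. ereal g \<ge> avg_reward A q r \<pi> x))
       \<and> (\<forall>(g::real) u. u \<in> Bw w \<and>
            (\<forall>x. \<forall>t\<ge>0. g \<le> rpi A r \<pi> t x + rate_int x (Qpi A q \<pi> t x) u)
          \<longrightarrow> (\<forall>x. ereal g \<le> avg_reward A q r \<pi> x))"
proof (intro conjI allI impI)
  interpret ctmdp_lyapunov A q r \<pi> w w' c b Mq M c' b' M'
    by unfold_locales (fact model pol assmA assmB)+
  fix g u x
  {
    assume *: "u \<in> Bw w \<and> (\<forall>x. \<forall>t\<ge>0. g \<ge> rpi A r \<pi> t x + rate_int x (Qpi A q \<pi> t x) u)"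
    then obtain K where "\<And>T. 0 \<le> T \<Longrightarrow> total_reward x T \<le> g * T + K"
      using total_reward_bound[of u 1 g x] by auto
    then show "ereal g \<ge> avg_reward A q r \<pi> x"
      unfolding avg_reward_total by (rule Liminf_average_le)
  next
    assume *: "u \<in> Bw w \<and> (\<forall>x. \<forall>t\<ge>0. g \<le> rpi A r \<pi> t x + rate_int x (Qpi A q \<pi> t x) u)"
    \<comment> \<open>The lower bound is the upper bound with all signs reversed, so the constant K
      reappears below as -K.\<close>
    have "-1 * (rpi A r \<pi> t x + rate_int x (Qpi A q \<pi> t x) u) \<le> -1 * g" if "0 \<le> t" for t x
      using *[THEN conjunct2, rule_format, OF that, of x] by simp
    from total_reward_bound[OF _ _ this] * obtain K where "\<forall>T\<ge>0. -1 * total_reward x T \<le> -1 * g * T + K"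
      by blast
    then have "g * T + - K \<le> total_reward x T" if "0 \<le> T" for T using that by fastforce
    then show "ereal g \<le> avg_reward A q r \<pi> x"
      unfolding avg_reward_total by (rule Liminf_average_ge)
  }
qed

end
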